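(* For every constant $\varepsilon\in(0,1/2)$, there exists a polynomial-time $(1/2-\varepsilon,O(\varepsilon^{-1}))$-bicriteria approximation algorithm for the problem of maximizing a non-negative submodular function $f\colon2^{\mathcal N}\to\mathbb R_{\ge0}$ subject to a cardinality constraint.
   Context: $f$ is submodular if $f(S\cup\{u\})-f(S)\ge f(T\cup\{u\})-f(T)$ for all $S\subseteq T\subseteq\mathcal N$, $u\notin T$; $f$ is accessed via a value oracle. A cardinality constraint with integer budget $B$ declares $S$ feasible iff $|S|\le B$. Let $OPT$ be a feasible set maximizing $f$. An $(\alpha,\beta)$-bicriteria approximation algorithm outputs $S$ with $\mathbb E[f(S)]\ge\alpha f(OPT)$ and $|S|\le\beta B$. *)

theory Defs
  imports Complex_Main
begin

definition submodular_on :: "nat set \<Rightarrow> (nat set \<Rightarrow> real) \<Rightarrow> bool" where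
  "submodular_on V f \<longleftrightarrow>
     (\<forall>S T u. S \<subseteq> T \<and> T \<subseteq> V \<and> u \<in> V \<and> u \<notin> T \<longrightarrow>
        f (S \<union> {u}) - f S \<ge> f (T \<union> {u}) - f T)"

definition nonneg_on :: "nat set \<Rightarrow> (nat set \<Rightarrow> real) \<Rightarrow> bool" where
  "nonneg_on V f \<longleftrightarrow> (\<forall>S. S \<subseteq> V \<longrightarrow> f S \<ge> 0)"

text \<open>Two register files: real registers R (holding reals) and nat registers N
 (used for counters/addresses). Each instruction costs one step; an oracle query
 costs one step. Arithmetic constants are integers. There is no real-to-integer
 conversion (no floor).\<close>

datatype instr =
    RConst nat int
  | RAdd nat nat nat
  | RSub nat nat nat
  | RMul nat nat nat
  | RDiv nat nat nat          (* division by zero yields 0 *)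
  | RLoad nat nat
  | RStore nat nat
  | NConst nat nat
  | NAdd nat nat nat
  | NSub nat nat nat          (* truncated subtraction *)
  | NtoR nat nat
  | JmpRLe nat nat nat
  | JmpNLe nat nat nat
  | Coin nat
  | Query nat nat
  | Halt

type_synonym program = "instr list"

record state =
  pc :: nat
  rreg :: "nat \<Rightarrow> real"
  nreg :: "nat \<Rightarrow> nat"

definition halted :: "program \<Rightarrow> state \<Rightarrow> bool" where
  "halted P s \<longleftrightarrow> pc s \<ge> length P \<or> P ! pc s = Halt"

definition exec_instr ::
  "(nat set \<Rightarrow> real) \<Rightarrow> nat \<Rightarrow> bool \<Rightarrow> instr \<Rightarrow> state \<Rightarrow> state" where
  "exec_instr f n b ins s = (let R = rreg s; Nr = nreg s; p' = Suc (pc s) in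
     case ins of
       RConst i c \<Rightarrow> s\<lparr>pc := p', rreg := R(i := of_int c)\<rparr>
     | RAdd i j k \<Rightarrow> s\<lparr>pc := p', rreg := R(i := R j + R k)\<rparr>
     | RSub i j k \<Rightarrow> s\<lparr>pc := p', rreg := R(i := R j - R k)\<rparr>
     | RMul i j k \<Rightarrow> s\<lparr>pc := p', rreg := R(i := R j * R k)\<rparr>
     | RDiv i j k \<Rightarrow> s\<lparr>pc := p', rreg := R(i := R j / R k)\<rparr>
     | RLoad i a \<Rightarrow> s\<lparr>pc := p', rreg := R(i := R (Nr a))\<rparr>
     | RStore a i \<Rightarrow> s\<lparr>pc := p', rreg := R(Nr a := R i)\<rparr>
     | NConst a m \<Rightarrow> s\<lparr>pc := p', nreg := Nr(a := m)\<rparr>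
     | NAdd a b' c \<Rightarrow> s\<lparr>pc := p', nreg := Nr(a := Nr b' + Nr c)\<rparr>
     | NSub a b' c \<Rightarrow> s\<lparr>pc := p', nreg := Nr(a := Nr b' - Nr c)\<rparr>
     | NtoR i a \<Rightarrow> s\<lparr>pc := p', rreg := R(i := real (Nr a))\<rparr>
     | JmpRLe i j t \<Rightarrow> s\<lparr>pc := (if R i \<le> R j then t else p')\<rparr>
     | JmpNLe a b' t \<Rightarrow> s\<lparr>pc := (if Nr a \<le> Nr b' then t else p')\<rparr>
     | Coin a \<Rightarrow> s\<lparr>pc := p', nreg := Nr(a := (if b then 1 else 0))\<rparr>
     | Query i a \<Rightarrow> s\<lparr>pc := p', rreg := R(i := f {x. x < n \<and> R (Nr a + x) \<noteq> 0})\<rparr>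
     | Halt \<Rightarrow> s)"

definition step ::
  "program \<Rightarrow> (nat set \<Rightarrow> real) \<Rightarrow> nat \<Rightarrow> bool \<Rightarrow> state \<Rightarrow> state" where
  "step P f n b s = (if halted P s then s else exec_instr f n b (P ! pc s) s)"

fun exec ::
  "program \<Rightarrow> (nat set \<Rightarrow> real) \<Rightarrow> nat \<Rightarrow> (nat \<Rightarrow> bool) \<Rightarrow> nat \<Rightarrow> state \<Rightarrow> state" where
  "exec P f n cs 0 s = s"
| "exec P f n cs (Suc t) s = step P f n (cs t) (exec P f n cs t s)"

definition init :: "nat \<Rightarrow> nat \<Rightarrow> state" where
  "init n B = \<lparr>pc = 0, rreg = (\<lambda>_. 0), nreg = (\<lambda>_. 0)(0 := n, 1 := B)\<rparr>"

definition alg_output :: "nat \<Rightarrow> state \<Rightarrow> nat set" where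
  "alg_output n s = {i. i < n \<and> rreg s i \<noteq> 0}"

definition run_T ::
  "program \<Rightarrow> (nat set \<Rightarrow> real) \<Rightarrow> nat \<Rightarrow> nat \<Rightarrow> nat \<Rightarrow> (nat \<Rightarrow> bool) \<Rightarrow> state" where
  "run_T P f n B T cs = exec P f n cs T (init n B)"

definition coins_of :: "bool list \<Rightarrow> nat \<Rightarrow> bool" where
  "coins_of bs i = (if i < length bs then bs ! i else False)"

text \<open>Expected value of f(output) when the program runs for T steps with
  T independent fair coins (only the first T coins can ever be read).\<close>
definition expected_value ::
  "program \<Rightarrow> (nat set \<Rightarrow> real) \<Rightarrow> nat \<Rightarrow> nat \<Rightarrow> nat \<Rightarrow> real" where
  "expected_value P f n B T =
     (\<Sum>bs \<in> {bs :: bool list. length bs = T}.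
        f (alg_output n (run_T P f n B T (coins_of bs)))) / 2 ^ T"

definition poly_bicriteria_alg :: "real \<Rightarrow> real \<Rightarrow> program \<Rightarrow> bool" where
  "poly_bicriteria_alg \<alpha> \<beta> P \<longleftrightarrow>
    (\<exists>c k::nat. \<forall>n B f. nonneg_on {..<n} f \<and> submodular_on {..<n} f \<longrightarrow>
       (let T = c * (n + 1) ^ k in
         (\<forall>cs. halted P (run_T P f n B T cs)
              \<and> real (card (alg_output n (run_T P f n B T cs))) \<le> \<beta> * real B)
       \<and> (\<forall>S. S \<subseteq> {..<n} \<and> card S \<le> B \<longrightarrow>
              expected_value P f n B T \<ge> \<alpha> * f S)))"

end

theory Submission
  imports Defs "HOL-Library.Disjoint_Sets"
begin

text \<open>
  Let \<open>F\<close> be the optimum, let \<open>v\<close> be a guess with \<open>F/2 \<le> v \<le> F\<close>, and put \<open>\<tau> = v/(kB)\<close> with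
  \<open>k \<approx> 2/\<epsilon>\<close>. One pass over the elements builds a set \<open>D\<^sub>1\<close> from the elements whose marginal gain
  exceeds \<open>\<tau>\<close>; the sets \<open>D\<^sub>2, \<dots>, D\<^sub>k\<close> are built in the same way from the elements not used so far, until
  the union \<open>A\<close> has \<open>6kB\<close> elements. Every output is a subset of \<open>A\<close>.

  For each \<open>j\<close>, the double greedy algorithm between \<open>D\<^sub>j\<close> and \<open>A\<close> returns a set of expected value at
  least \<open>f(S)/2 + f(D\<^sub>j)/4\<close>, for every \<open>D\<^sub>j \<subseteq> S \<subseteq> A\<close>. Take \<open>S = D\<^sub>j \<union> (OPT \<inter> A)\<close>. The elements of
  \<open>OPT - A\<close> have marginal gain at most \<open>\<tau>\<close>, so \<open>f(S) \<ge> f(OPT \<union> D\<^sub>j) - F/k\<close>, and since the \<open>D\<^sub>j\<close> are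
  disjoint, the average of \<open>f(OPT \<union> D\<^sub>j)\<close> over \<open>m\<close> of them is at least \<open>(1 - 1/m) F\<close>. If all \<open>k\<close> sets
  are completed, the loss \<open>1/m\<close> is \<open>1/k\<close>. If \<open>A\<close> fills up earlier, then \<open>\<Sum> f(D\<^sub>j) \<ge> 6v \<ge> 3F\<close>: either the
  last, incomplete set is itself worth \<open>F\<close>, or the bonus terms \<open>f(D\<^sub>j)/4\<close> of the completed sets
  pay for the loss. So the number of sets adapts to their values, which is what keeps \<open>A\<close> of size
  \<open>O(B/\<epsilon>)\<close> instead of \<open>O(B/\<epsilon>\<^sup>2)\<close>.

  The guesses are the multiples of \<open>M/(2n)\<close> up to \<open>M\<close>, where \<open>M\<close> is the sum of all singleton values. Biased
  coins are simulated by \<open>n + k\<close> fair ones up to an error of \<open>2^-(n+k)\<close>.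
\<close>

section \<open>Submodular functions\<close>

lemma submodular_on_insert:
  assumes "submodular_on V f" "S \<subseteq> T" "T \<subseteq> V" "u \<in> V" "u \<notin> T"
  shows "f (insert u T) - f T \<le> f (insert u S) - f S"
  using assms unfolding submodular_on_def by (metis Un_insert_right sup_bot.right_neutral)

lemma submodular_on_Un:
  assumes sm: "submodular_on V f" and "S \<subseteq> T" "T \<subseteq> V" and "finite C" "C \<subseteq> V" "C \<inter> T = {}"
  shows "f (T \<union> C) - f T \<le> f (S \<union> C) - f S"
  using assms(4-6)
proof (induction C rule: finite_induct)
  case (insert x C)
  have "f (insert x (T \<union> C)) - f (T \<union> C) \<le> f (insert x (S \<union> C)) - f (S \<union> C)"
    using insert assms(2,3) by (intro submodular_on_insert[OF sm]) auto
  then show ?case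
    using insert by auto
qed simp

text \<open>\<open>S \<union> T\<close> and \<open>S\<close> arise by adding the same block
  \<open>S - T\<close> to \<open>T\<close> and to its subset \<open>S \<inter> T\<close>;
  diminishing returns compare the two gains.\<close>

lemma submodular_on_lattice:
  assumes "submodular_on V f" "finite V" "S \<subseteq> V" "T \<subseteq> V"
  shows "f (S \<union> T) + f (S \<inter> T) \<le> f S + f T"
proof -
  have "f (T \<union> (S - T)) - f T \<le> f (S \<inter> T \<union> (S - T)) - f (S \<inter> T)"
    using assms by (intro submodular_on_Un[OF assms(1)]) (auto intro: finite_subset)
  moreover have "T \<union> (S - T) = S \<union> T" "S \<inter> T \<union> (S - T) = S"
    by auto
  ultimately show ?thesis
    by simp
qed

lemma submodular_on_Un_le_sum:
  assumes sm: "submodular_on V f" and "S \<subseteq> V" "finite C" "C \<subseteq> V" "C \<inter> S = {}"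
  shows "f (S \<union> C) - f S \<le> (\<Sum>x\<in>C. f (insert x S) - f S)"
  using assms(3-5)
proof (induction C rule: finite_induct)
  case (insert x C)
  have "f (insert x (S \<union> C)) - f (S \<union> C) \<le> f (insert x S) - f S"
    using insert assms(2) by (intro submodular_on_insert[OF sm]) auto
  then show ?case
    using insert by auto
qed simp

text \<open>The induction starts at a singleton because \<open>f {}\<close> may be positive, which
  would break the bound for empty \<open>S\<close>; each further element gains at most
  \<open>f {x} - f {}\<close>.\<close>

lemma submodular_on_le_sum_singletons:
  assumes sm: "submodular_on V f" and nn: "nonneg_on V f" and "finite S" "S \<subseteq> V" "S \<noteq> {}"
  shows "f S \<le> (\<Sum>x\<in>S. f {x})"
  using assms(3,5,4)
proof (induction S rule: finite_ne_induct)
  case (insert x C)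
  have "f (insert x C) - f C \<le> f {x} - f {}"
    using insert by (intro submodular_on_insert[OF sm]) auto
  moreover have "f {} \<ge> 0"
    using nn unfolding nonneg_on_def by simp
  ultimately show ?case
    using insert by auto
qed simp

text \<open>This stands in for monotonicity: on average, adding one of the \<open>D j\<close>
  destroys little of \<open>f S\<close>. By disjointness, \<open>S \<union> D i\<close> meets the
  union of \<open>S\<close> with the other sets exactly in \<open>S\<close>, so each use of the
  lattice inequality merges one set and releases one copy of \<open>f S\<close>. Non-negativity
  drops the final union.\<close>

lemma submodular_on_disjoint_family:
  assumes sm: "submodular_on V f" and nn: "nonneg_on V f" and fin: "finite V" and S: "S \<subseteq> V"
    and D: "\<And>j. j \<in> J \<Longrightarrow> D j \<subseteq> V" "disjoint_family_on D J" and J: "finite J"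
  shows "(real (card J) - 1) * f S \<le> (\<Sum>j\<in>J. f (S \<union> D j))"
proof -
  have "(real (card J) - 1) * f S + f (S \<union> (\<Union>j\<in>J. D j)) \<le> (\<Sum>j\<in>J. f (S \<union> D j))"
    using J D
  proof (induction J rule: finite_induct)
    case (insert i J)
    have D: "\<And>j. j \<in> insert i J \<Longrightarrow> D j \<subseteq> V"
      using insert.prems by blast
    have disj: "D i \<inter> D j = {}" if "j \<in> J" for j
      using insert.prems(2) insert.hyps(2) that by (auto simp: disjoint_family_on_def)
    have "f ((S \<union> (\<Union>j\<in>J. D j)) \<union> (S \<union> D i)) + f ((S \<union> (\<Union>j\<in>J. D j)) \<inter> (S \<union> D i))
        \<le> f (S \<union> (\<Union>j\<in>J. D j)) + f (S \<union> D i)"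
      using D S by (intro submodular_on_lattice[OF sm fin]) auto
    moreover have "(S \<union> (\<Union>j\<in>J. D j)) \<inter> (S \<union> D i) = S"
      using disj by blast
    moreover have "(S \<union> (\<Union>j\<in>J. D j)) \<union> (S \<union> D i) = S \<union> (\<Union>j\<in>insert i J. D j)"
      by blast
    moreover have "(real (card J) - 1) * f S + f (S \<union> (\<Union>j\<in>J. D j)) \<le> (\<Sum>j\<in>J. f (S \<union> D j))"
      using insert.IH D insert.prems(2) by (auto simp: disjoint_family_on_def)
    ultimately show ?case
      using insert.hyps by (simp add: algebra_simps)
  qed simp
  moreover have "f (S \<union> (\<Union>j\<in>J. D j)) \<ge> 0"
    using nn S D(1) unfolding nonneg_on_def by (simp add: UN_least)
  ultimately show ?thesis
    by linarith
qed

section \<open>Existence of a good starting set\<close>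

text \<open>If every candidate failed, summing over \<open>{1..J}\<close> would give a
  contradiction. The disjoint family loses \<open>F / 2\<close> in total. It is paid by the
  \<open>F / (2 k)\<close> that each set has left after the elements of \<open>opt - A\<close>, and
  by the bonus terms \<open>f (D j) / 4\<close>; \<open>enough\<close> is twice this
  balance.\<close>

lemma exists_good_start:
  fixes \<tau> F :: real and J k :: nat
  assumes sm: "submodular_on V f" and nn: "nonneg_on V f" and fin: "finite V"
    and D: "\<And>j. j \<in> {1..k} \<Longrightarrow> D j \<subseteq> V" "disjoint_family_on D {1..k}"
    and A: "A = (\<Union>j\<in>{1..k}. D j)"
    and opt: "opt \<subseteq> V" "card opt \<le> B" "f opt = F"
    and \<tau>: "real B * \<tau> \<le> F / k" "0 \<le> \<tau>"
    and J: "1 \<le> J" "J \<le> k"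
    and small: "\<And>j x. j \<in> {1..J} \<Longrightarrow> x \<in> V - A \<Longrightarrow> f (insert x (D j)) - f (D j) \<le> \<tau>"
    and enough: "F \<le> J * F / k + (\<Sum>j\<in>{1..J}. f (D j)) / 2"
  shows "\<exists>j\<in>{1..J}. \<exists>S. D j \<subseteq> S \<and> S \<subseteq> A \<and> F / 2 - F / k \<le> f S / 2 + f (D j) / 4"
proof (rule ccontr)
  assume neg: "\<not> ?thesis"
  \<comment> \<open>\<open>q\<close> hides the product, so that the closing arithmetic is
    linear.\<close>
  define q where "q = J * F / k"
  define S where "S j = D j \<union> (opt \<inter> A)" for j
  have S: "f (opt \<union> D j) - F / k \<le> f (S j)" "D j \<subseteq> S j" "S j \<subseteq> A" if j: "j \<in> {1..J}" for j
  proof -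
    have jk: "j \<in> {1..k}"
      using j J by auto
    then show sub: "D j \<subseteq> S j" "S j \<subseteq> A"
      unfolding S_def A by auto
    have AV: "A \<subseteq> V"
      using D(1) unfolding A by blast
    have eq: "opt \<union> D j = S j \<union> (opt - A)"
      using jk unfolding S_def A by auto
    have fopt: "finite (opt - A)"
      using opt(1) fin by (auto intro: finite_subset)
    have "f (S j \<union> (opt - A)) - f (S j) \<le> (\<Sum>x\<in>opt - A. f (insert x (S j)) - f (S j))"
      using sub(2) AV opt(1) fopt by (intro submodular_on_Un_le_sum[OF sm]) auto
    also have "\<dots> \<le> (\<Sum>x\<in>opt - A. \<tau>)"
    proof (rule sum_mono)
      fix x assume x: "x \<in> opt - A"
      have "f (insert x (S j)) - f (S j) \<le> f (insert x (D j)) - f (D j)"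
        using sub AV x opt(1) by (intro submodular_on_insert[OF sm]) auto
      also have "\<dots> \<le> \<tau>"
        using small[OF j] x opt(1) by auto
      finally show "f (insert x (S j)) - f (S j) \<le> \<tau>" .
    qed
    also have "\<dots> \<le> real B * \<tau>"
    proof -
      have "card (opt - A) \<le> card opt"
        using opt(1) fin by (intro card_mono) (auto intro: finite_subset)
      then show ?thesis
        using opt(2) \<tau>(2) by (simp add: mult_right_mono)
    qed
    finally show "f (opt \<union> D j) - F / k \<le> f (S j)"
      using eq \<tau>(1) by simp
  qed
  have "(\<Sum>j\<in>{1..J}. f (S j) / 2 + f (D j) / 4) < (\<Sum>j\<in>{1..J}. F / 2 - F / k)"
    using neg S J(1) by (intro sum_strict_mono) (auto simp: not_le)
  moreover have "(\<Sum>j\<in>{1..J}. (f (opt \<union> D j) - F / k) / 2 + f (D j) / 4)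
      \<le> (\<Sum>j\<in>{1..J}. f (S j) / 2 + f (D j) / 4)"
    using S(1) by (intro sum_mono add_right_mono divide_right_mono) auto
  moreover have "(real J - 1) * F \<le> (\<Sum>j\<in>{1..J}. f (opt \<union> D j))"
    using submodular_on_disjoint_family[OF sm nn fin opt(1), of "{1..J}" D] D J opt(3)
    by (auto simp: disjoint_family_on_def)
  moreover have "(\<Sum>j\<in>{1..J}. F / 2 - F / k) = J * F / 2 - q"
    by (simp add: algebra_simps q_def)
  moreover have "(\<Sum>j\<in>{1..J}. (f (opt \<union> D j) - F / k) / 2 + f (D j) / 4) =
      (\<Sum>j\<in>{1..J}. f (opt \<union> D j)) / 2 - q / 2 + (\<Sum>j\<in>{1..J}. f (D j)) / 4"
    by (simp add: q_def sum.distrib sum_subtractf diff_divide_distrib flip: sum_divide_distrib)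
  moreover have "(real J - 1) * F = J * F - F"
    by (simp add: algebra_simps)
  ultimately show False
    using enough[folded q_def] by linarith
qed

text \<open>If all \<open>k\<close> passes are complete, \<open>J * F / k = F\<close> alone gives
  \<open>enough\<close>. Otherwise \<open>A\<close> is full, and the limit \<open>6 * k * B\<close>
  is tuned for this case: every element is worth \<open>v / (k B)\<close>, so the sets are worth at
  least \<open>6 v\<close>, hence \<open>3 F\<close>. One \<open>F\<close> is reserved for the set
  of pass \<open>Suc J\<close>; the remaining \<open>2 F\<close> satisfy \<open>enough\<close>,
  which halves them.\<close>

lemma exists_good_start_cases:
  fixes v F :: real and J k :: nat
  assumes sm: "submodular_on V f" and nn: "nonneg_on V f" and fin: "finite V"
    and D: "\<And>j. j \<in> {1..k} \<Longrightarrow> D j \<subseteq> V" "disjoint_family_on D {1..k}"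
    and A: "A = (\<Union>j\<in>{1..k}. D j)"
    and opt: "opt \<subseteq> V" "card opt \<le> B" "f opt = F"
    and v: "F / 2 \<le> v" "v \<le> F" "0 < F" and B: "1 \<le> B" and k: "1 \<le> k"
    and \<tau>: "\<tau> = v / (real k * real B)"
    and gain: "\<And>j. j \<in> {1..k} \<Longrightarrow> \<tau> * card (D j) \<le> f (D j)"
    and J: "J \<le> k"
    and small: "\<And>j x. j \<in> {1..J} \<Longrightarrow> x \<in> V - A \<Longrightarrow> f (insert x (D j)) - f (D j) \<le> \<tau>"
    and alt: "J = k \<or> (J < k \<and> card A = 6 * k * B \<and> (\<forall>j\<in>{1..k}. j > Suc J \<longrightarrow> D j = {}))"
  shows "\<exists>j\<in>{1..k}. \<exists>S. D j \<subseteq> S \<and> S \<subseteq> A \<and> F / 2 - F / k \<le> f S / 2 + f (D j) / 4"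
proof -
  have \<tau>1: "real B * \<tau> \<le> F / k" "0 \<le> \<tau>"
  proof -
    have "real B * \<tau> = v / k"
      using B by (simp add: \<tau>)
    then show "real B * \<tau> \<le> F / k"
      using v by (simp add: divide_right_mono)
    show "0 \<le> \<tau>"
      using v by (simp add: \<tau>)
  qed
  have nnD: "0 \<le> f (D j)" if "j \<in> {1..k}" for j
    using nn D(1)[OF that] unfolding nonneg_on_def by simp
  have *: ?thesis if "1 \<le> J" "F \<le> J * F / k + (\<Sum>j\<in>{1..J}. f (D j)) / 2"
  proof -
    have "\<exists>j\<in>{1..J}. \<exists>S. D j \<subseteq> S \<and> S \<subseteq> A \<and> F / 2 - F / k \<le> f S / 2 + f (D j) / 4"
      by (rule exists_good_start[OF sm nn fin D A opt \<tau>1 that(1) J small that(2)])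
    moreover have "{1..J} \<subseteq> {1..k}"
      using J by simp
    ultimately show ?thesis
      by blast
  qed
  from alt show ?thesis
  proof
    assume "J = k"
    moreover have "0 \<le> (\<Sum>j\<in>{1..k}. f (D j))"
      using nnD by (intro sum_nonneg) auto
    ultimately show ?thesis
      using k by (intro *) auto
  next
    assume J': "J < k \<and> card A = 6 * k * B \<and> (\<forall>j\<in>{1..k}. j > Suc J \<longrightarrow> D j = {})"
    have AJ: "A = (\<Union>j\<in>{1..Suc J}. D j)"
    proof
      show "A \<subseteq> (\<Union>j\<in>{1..Suc J}. D j)"
      proof
        fix x assume "x \<in> A"
        then obtain j where j: "j \<in> {1..k}" "x \<in> D j"
          unfolding A by auto
        then have "j \<le> Suc J"
          using J' by (metis empty_iff not_le)
        then show "x \<in> (\<Union>j\<in>{1..Suc J}. D j)"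
          using j by auto
      qed
      show "(\<Union>j\<in>{1..Suc J}. D j) \<subseteq> A"
        using J' unfolding A by (intro UN_mono) auto
    qed
    have "card A \<le> (\<Sum>j\<in>{1..Suc J}. card (D j))"
      unfolding AJ by (intro card_UN_le) simp
    then have "\<tau> * card A \<le> \<tau> * (\<Sum>j\<in>{1..Suc J}. card (D j))"
      using \<tau>1(2) of_nat_mono by (intro mult_left_mono)
    also have "\<dots> = (\<Sum>j\<in>{1..Suc J}. \<tau> * card (D j))"
      by (simp add: sum_distrib_left distrib_left)
    also have "\<dots> \<le> (\<Sum>j\<in>{1..Suc J}. f (D j))"
      using gain J' by (intro sum_mono) auto
    finally have "\<tau> * card A \<le> (\<Sum>j\<in>{1..J}. f (D j)) + f (D (Suc J))"
      by simp
    moreover have "\<tau> * card A = 6 * v"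
      using J' B k by (simp add: \<tau>)
    ultimately have "6 * v \<le> (\<Sum>j\<in>{1..J}. f (D j)) + f (D (Suc J))"
      by simp
    then have ge: "3 * F \<le> (\<Sum>j\<in>{1..J}. f (D j)) + f (D (Suc J))"
      using v by linarith
    \<comment> \<open>Pass \<open>Suc J\<close> may be incomplete, so
      \<open>exists_good_start\<close> does not cover its set. If that set is worth
      \<open>F\<close>, it serves as \<open>S\<close> itself; otherwise its value can be
      ignored.\<close>
    show ?thesis
    proof (cases "F \<le> f (D (Suc J))")
      case True
      have "0 \<le> F / k"
        using v by simp
      then have "F / 2 - F / k \<le> f (D (Suc J)) / 2 + f (D (Suc J)) / 4"
        using True v by linarith
      moreover have "D (Suc J) \<subseteq> A" "Suc J \<in> {1..k}"
        using J' AJ by auto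
      ultimately show ?thesis
        by blast
    next
      case False
      then have "2 * F \<le> (\<Sum>j\<in>{1..J}. f (D j))"
        using ge by linarith
      moreover from this have "1 \<le> J"
        using v by (cases J) auto
      moreover have "0 \<le> J * F / k"
        using v by simp
      ultimately show ?thesis
        by (intro *) linarith+
    qed
  qed
qed

section \<open>Biased coins and one step of double greedy\<close>

text \<open>The probability that a real \<open>x\<close>, repeatedly replaced by \<open>2x\<close> or \<open>2x - 1\<close> with equal
  probability, is at least \<open>1\<close> after \<open>r\<close> rounds. Clamping to the unit interval is a fixed point of
  this averaging, hence the accuracy \<open>2^-r\<close>.\<close>

fun bias :: "nat \<Rightarrow> real \<Rightarrow> real" where
  "bias 0 x = (if 1 \<le> x then 1 else 0)"
| "bias (Suc r) x = (bias r (2 * x) + bias r (2 * x - 1)) / 2"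

lemma bias_eq_1: "1 \<le> x \<Longrightarrow> bias r x = 1"
  by (induction r arbitrary: x) simp_all

lemma bias_eq_0: "x \<le> 0 \<Longrightarrow> bias r x = 0"
  by (induction r arbitrary: x) simp_all

text \<open>One of \<open>2 * x\<close> and \<open>2 * x - 1\<close> lies outside the open unit
  interval, where \<open>bias\<close> is exact, so a round halves the error inherited from the other
  one. The rounding is one-sided: the probability is never too large.\<close>

lemma bias_bounds: "0 \<le> x \<Longrightarrow> x \<le> 1 \<Longrightarrow> x - 1 / 2 ^ r \<le> bias r x \<and> bias r x \<le> x"
proof (induction r arbitrary: x)
  case (Suc r)
  show ?case
  proof (cases "2 * x \<le> 1")
    case True
    then show ?thesis
      using Suc.IH[of "2 * x"] Suc.prems bias_eq_0[of "2 * x - 1"] by (simp add: field_simps)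
  next
    case False
    then show ?thesis
      using Suc.IH[of "2 * x - 1"] Suc.prems bias_eq_1[of "2 * x"] by (simp add: field_simps)
  qed
qed auto

text \<open>The two claims are for an element inside and outside the target set. With
  \<open>d\<close> replaced by its worst value, \<open>a\<close> or \<open>- b\<close>, each claim
  for the exact probability \<open>q\<close> reduces to \<open>(a - b)^2 / (a + b) \<ge> 0\<close>.
  Using \<open>p\<close> instead of \<open>q\<close> costs at most
  \<open>\<eta> * a\<close>.\<close>

lemma double_greedy_arith:
  fixes a b d \<eta> p F :: real
  assumes ab: "0 < a" "0 < b" and d: "- b \<le> d" "d \<le> a"
    and p: "a / (a + b) - \<eta> \<le> p" "p \<le> a / (a + b)" "0 \<le> p" and \<eta>: "0 \<le> \<eta>" and F: "a \<le> F"
  shows "d / 2 - b / 4 - \<eta> * F \<le> p * (d / 2 + a / 4 - b / 4)"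
    and "- b / 4 - \<eta> * F \<le> p * (d / 2 + a / 4 - b / 4)"
proof -
  define q where "q = a / (a + b)"
  have q: "q * (a + b) = a" "0 \<le> q" "q \<le> 1"
    using ab by (auto simp: q_def)
  have pq: "q - \<eta> \<le> p" "p \<le> q"
    using p by (auto simp: q_def)
  have \<eta>F: "\<eta> * a \<le> \<eta> * F"
    using F \<eta> by (rule mult_left_mono)
  have \<eta>a: "0 \<le> \<eta> * a"
    using ab \<eta> by simp
  have p1: "0 \<le> 1 - p"
    using pq q by linarith
  have e: "(q - p) * a \<le> \<eta> * a"
    using pq ab by (intro mult_right_mono) auto
  have e0: "0 \<le> (q - p) * b"
    using pq ab by (intro mult_nonneg_nonneg) auto
  have sq: "0 \<le> (a - b)\<^sup>2 / (a + b)"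
    using ab by simp
  have sq': "(a - b)\<^sup>2 / (a + b) = q * (a - 3 * b) + b"
    using ab by (simp add: q_def field_simps power2_eq_square)
  have sq'': "(a - b)\<^sup>2 / (a + b) = q * (3 * a - b) - 2 * a + b"
    using ab by (simp add: q_def field_simps power2_eq_square)
  have "(1 - p) * d \<le> (1 - p) * a"
    using d p1 by (intro mult_left_mono) auto
  then show "d / 2 - b / 4 - \<eta> * F \<le> p * (d / 2 + a / 4 - b / 4)"
    using sq sq'' e e0 \<eta>F \<eta>a by (simp add: algebra_simps)
  have "p * (- b) \<le> p * d"
    using d p by (intro mult_left_mono) auto
  then show "- b / 4 - \<eta> * F \<le> p * (d / 2 + a / 4 - b / 4)"
    using sq sq' e e0 \<eta>F \<eta>a by (simp add: algebra_simps)
qed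

text \<open>\<open>Y\<close> is the upper set without \<open>u\<close>, so the state before the
  decision is \<open>X\<close>, \<open>insert u Y\<close>, with target \<open>S'\<close>. Rejecting
  leads to \<open>X\<close>, \<open>Y\<close>, \<open>S\<close>, and accepting inserts
  \<open>u\<close> into all three. The weighted potential drops by no more than the coin error in
  expectation.\<close>

lemma double_greedy_step:
  fixes F :: real
  assumes sm: "submodular_on V f" and u: "u \<in> V" "u \<notin> Y" and sub: "X \<subseteq> S" "S \<subseteq> Y" "Y \<subseteq> V"
    and a: "a = f (insert u X) - f X" and b: "b = f Y - f (insert u Y)"
    and x: "x = (if b \<le> 0 then 1 else a / (a + b))"
    and F: "a \<le> F" "0 \<le> F"
    and S': "S' = S \<or> S' = insert u S"
    and rej: "vr = f S / 2 + f X / 4 + f Y / 4"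
    and acc: "va = f (insert u S) / 2 + f (insert u X) / 4 + f (insert u Y) / 4"
  shows "f S' / 2 + f X / 4 + f (insert u Y) / 4 - F / 2 ^ r \<le> vr + bias r x * (va - vr)"
proof -
  define d where "d = f (insert u S) - f S"
  have d: "- b \<le> d" "d \<le> a"
    using submodular_on_insert[OF sm, of S Y u] submodular_on_insert[OF sm, of X S u] u sub
    by (auto simp: a b d_def)
  have va: "va - vr = d / 2 + a / 4 - b / 4"
    by (simp add: rej acc a b d_def field_simps)
  have \<eta>: "0 \<le> F / 2 ^ r"
    using F by simp
  have lhs: "f S' / 2 + f X / 4 + f (insert u Y) / 4 =
      vr + (if S' = S then 0 else d / 2) - b / 4"
    using S' by (auto simp: rej b d_def field_simps)
  consider "b \<le> 0" | "0 < b" "a \<le> 0" | "0 < b" "0 < a"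
    by linarith
  then show ?thesis
  proof cases
    case 1
    then have "bias r x = 1"
      by (simp add: x bias_eq_1)
    then show ?thesis
      using 1 d va \<eta> unfolding lhs by simp
  next
    \<comment> \<open>By \<open>d\<close> the denominator \<open>a + b\<close> is non-negative.
      Should it vanish, the quotient is 0 by convention, which is again the right decision.\<close>
    case 2
    then have "x \<le> 0"
      using d by (simp add: x divide_nonpos_nonneg)
    then have "bias r x = 0"
      by (rule bias_eq_0)
    then show ?thesis
      using 2 d \<eta> unfolding lhs by simp
  next
    case 3
    then have x': "x = a / (a + b)" "0 \<le> x" "x \<le> 1"
      by (auto simp: x)
    have nn: "0 \<le> bias r x"
      by (induction r arbitrary: x) simp_all
    have bb: "x - 1 / 2 ^ r \<le> bias r x" "bias r x \<le> x"
      using bias_bounds[OF x'(2,3)] by auto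
    show ?thesis
      using double_greedy_arith[OF 3(2,1) d bb[unfolded x'(1)] nn[unfolded x'(1)] _ F(1)]
      unfolding lhs va x'(1) by (simp split: if_splits)
  qed
qed

section \<open>Structured programs and expected values\<close>

datatype cmd =
    Block "instr list"
  | Flip nat
  | Seq cmd cmd  (infixr ";;" 60)
  | IfR nat nat cmd cmd
  | IfN nat nat cmd cmd
  | While nat nat cmd

primrec csize :: "cmd \<Rightarrow> nat" where
  "csize (Block xs) = length xs"
| "csize (Flip a) = 1"
| "csize (Seq c d) = csize c + csize d"
| "csize (IfR i j c d) = csize c + csize d + 2"
| "csize (IfN i j c d) = csize c + csize d + 2"
| "csize (While a b c) = csize c + 2"

text \<open>\<open>While a b\<close> loops as long as register \<open>a\<close> is smaller than register \<open>b\<close>;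
  \<open>JmpNLe 0 0\<close> serves as the unconditional jump.\<close>

primrec code :: "cmd \<Rightarrow> nat \<Rightarrow> instr list" where
  "code (Block xs) p = xs"
| "code (Flip a) p = [Coin a]"
| "code (Seq c d) p = code c p @ code d (p + csize c)"
| "code (IfR i j c d) p =
     JmpRLe i j (p + csize d + 2) # code d (p + 1) @
     JmpNLe 0 0 (p + csize c + csize d + 2) # code c (p + csize d + 2)"
| "code (IfN i j c d) p =
     JmpNLe i j (p + csize d + 2) # code d (p + 1) @
     JmpNLe 0 0 (p + csize c + csize d + 2) # code c (p + csize d + 2)"
| "code (While a b c) p = JmpNLe b a (p + csize c + 2) # code c (p + 1) @ [JmpNLe 0 0 p]"

lemma length_code [simp]: "length (code c p) = csize c"
  by (induction c arbitrary: p) auto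

text \<open>Running time when every loop makes at most \<open>K\<close> iterations.\<close>

primrec cost :: "nat \<Rightarrow> cmd \<Rightarrow> nat" where
  "cost K (Block xs) = length xs"
| "cost K (Flip a) = 1"
| "cost K (Seq c d) = cost K c + cost K d"
| "cost K (IfR i j c d) = cost K c + cost K d + 2"
| "cost K (IfN i j c d) = cost K c + cost K d + 2"
| "cost K (While a b c) = K * (cost K c + 2) + 1"

lemma add_polynomial:
  fixes g h :: "nat \<Rightarrow> nat"
  assumes "\<exists>a d. \<forall>K. g K \<le> a * (K + 1) ^ d" "\<exists>a d. \<forall>K. h K \<le> a * (K + 1) ^ d"
  shows "\<exists>a d. \<forall>K. g K + h K + e \<le> a * (K + 1) ^ d"
proof -
  obtain a d a' d' where ad: "\<And>K. g K \<le> a * (K + 1) ^ d" "\<And>K. h K \<le> a' * (K + 1) ^ d'"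
    using assms by blast
  have "g K + h K + e \<le> (a + a' + e) * (K + 1) ^ (d + d')" for K
  proof -
    have "a * (K + 1) ^ d \<le> a * (K + 1) ^ (d + d')" "a' * (K + 1) ^ d' \<le> a' * (K + 1) ^ (d + d')"
      by (intro mult_left_mono power_increasing; simp)+
    moreover have "e * 1 \<le> e * (K + 1) ^ (d + d')"
      by (intro mult_left_mono) auto
    ultimately have "g K + h K + e \<le>
        a * (K + 1) ^ (d + d') + a' * (K + 1) ^ (d + d') + e * (K + 1) ^ (d + d')"
      using ad[of K] by linarith
    then show ?thesis
      by (simp add: distrib_right)
  qed
  then show ?thesis
    by blast
qed

text \<open>Each loop raises the degree by at most one. As \<open>K\<close> will be linear in
  \<open>n\<close>, this is the polynomial time bound.\<close>

lemma cost_polynomial: "\<exists>a d. \<forall>K. cost K c \<le> a * (K + 1) ^ d"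
proof (induction c)
  case (Block xs)
  have "cost K (Block xs) \<le> length xs * (K + 1) ^ 0" for K
    by simp
  then show ?case
    by blast
next
  case (Flip a)
  have "cost K (Flip a) \<le> 1 * (K + 1) ^ 0" for K
    by simp
  then show ?case
    by blast
next
  case (Seq c1 c2)
  then show ?case
    using add_polynomial[of "\<lambda>K. cost K c1" "\<lambda>K. cost K c2" 0] by simp
next
  case (IfR i j c1 c2)
  then show ?case
    using add_polynomial[of "\<lambda>K. cost K c1" "\<lambda>K. cost K c2" 2] by simp
next
  case (IfN i j c1 c2)
  then show ?case
    using add_polynomial[of "\<lambda>K. cost K c1" "\<lambda>K. cost K c2" 2] by simp
next
  case (While i j c)
  then obtain a d where ad: "\<And>K. cost K c \<le> a * (K + 1) ^ d"
    by blast
  have "cost K (While i j c) \<le> (a + 3) * (K + 1) ^ Suc d" for K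
  proof -
    have one: "1 \<le> (K + 1) ^ d"
      by simp
    have "cost K c + 2 \<le> (a + 2) * (K + 1) ^ d"
      using ad[of K] one unfolding distrib_right by linarith
    then have "K * (cost K c + 2) + 1 \<le> K * ((a + 2) * (K + 1) ^ d) + (K + 1) ^ Suc d"
      using one by (intro add_mono mult_left_mono) (auto simp del: power_Suc)
    also have "\<dots> \<le> (K + 1) * ((a + 2) * (K + 1) ^ d) + (K + 1) ^ Suc d"
      by (intro add_right_mono mult_right_mono) auto
    also have "\<dots> = (a + 3) * (K + 1) ^ Suc d"
      by (simp add: algebra_simps)
    finally show ?thesis
      by simp
  qed
  then show ?case
    by blast
qed

definition placed :: "program \<Rightarrow> nat \<Rightarrow> instr list \<Rightarrow> bool" where
  "placed P p xs \<longleftrightarrow> (\<exists>us vs. P = us @ xs @ vs \<and> length us = p)"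

lemma placed_append: "placed P p (xs @ ys) \<Longrightarrow> placed P p xs \<and> placed P (p + length xs) ys"
  unfolding placed_def by (metis append.assoc length_append)

lemma placed_Cons: "placed P p (x # xs) \<Longrightarrow> p < length P \<and> P ! p = x \<and> placed P (Suc p) xs"
  unfolding placed_def
  by (metis (no_types, lifting) Cons_eq_appendI append_Nil append.assoc length_append_singleton
      length_append length_Cons nth_append_length add_Suc_right less_add_Suc1)

text \<open>These instructions act deterministically on the registers and pass control to the next
  position.\<close>

primrec straight :: "instr \<Rightarrow> bool" where
  "straight (RConst i c) = True"
| "straight (RAdd i j k) = True"
| "straight (RSub i j k) = True"
| "straight (RMul i j k) = True"
| "straight (RDiv i j k) = True"
| "straight (RLoad i a) = True"
| "straight (RStore a i) = True"
| "straight (NConst a m) = True"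
| "straight (NAdd a b c) = True"
| "straight (NSub a b c) = True"
| "straight (NtoR i a) = True"
| "straight (JmpRLe i j t) = False"
| "straight (JmpNLe a b t) = False"
| "straight (Coin a) = False"
| "straight (Query i a) = True"
| "straight Halt = False"

text \<open>\<open>exec\<close> unfolds at its last step, whereas program correctness is argued from
  the first one; peeling that off shifts the coin sequence.\<close>

lemma exec_Suc_shift:
  "exec P f n cs (Suc t) s = exec P f n (\<lambda>i. cs (Suc i)) t (step P f n (cs 0) s)"
  by (induction t) simp_all

lemma coins_of_Cons [simp]:
  "coins_of (b # bs) 0 = b" "coins_of (b # bs) (Suc i) = coins_of bs i"
  by (simp_all add: coins_of_def)

section \<open>Expected values along a run\<close>

text \<open>\<open>bound\<close> limits the size of the output and \<open>K\<close> the number of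
  iterations of every loop.\<close>

locale oracle_machine =
  fixes f :: "nat set \<Rightarrow> real" and n :: nat and bound :: nat and K :: nat
begin

definition mean :: "program \<Rightarrow> nat \<Rightarrow> state \<Rightarrow> real" where
  "mean P T s = (\<Sum>bs \<in> {bs :: bool list. length bs = T}.
     f (alg_output n (exec P f n (coins_of bs) T s))) / 2 ^ T"

lemma mean_0 [simp]: "mean P 0 s = f (alg_output n s)"
  by (simp add: mean_def)

text \<open>This conditions on the first coin. Every step consumes a coin, even if it does not read
  it, so the recursion is the same for all instructions.\<close>

lemma mean_Suc:
  "mean P (Suc T) s = (mean P T (step P f n True s) + mean P T (step P f n False s)) / 2"
proof -
  define g where "g bs = f (alg_output n (exec P f n (coins_of bs) (Suc T) s))" for bs
  have lists: "{bs :: bool list. length bs = Suc T} =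
      (#) True ` {bs. length bs = T} \<union> (#) False ` {bs. length bs = T}"
  proof (rule set_eqI)
    fix bs :: "bool list"
    show "bs \<in> {bs. length bs = Suc T} \<longleftrightarrow>
        bs \<in> (#) True ` {bs. length bs = T} \<union> (#) False ` {bs. length bs = T}"
      by (cases bs; cases "hd bs") auto
  qed
  have fin: "finite {bs :: bool list. length bs = T}"
    using finite_lists_length_eq[of "UNIV :: bool set" T] by simp
  have "(\<Sum>bs \<in> {bs :: bool list. length bs = Suc T}. g bs) =
      (\<Sum>bs \<in> {bs. length bs = T}. g (True # bs)) + (\<Sum>bs \<in> {bs. length bs = T}. g (False # bs))"
    unfolding lists using fin
    by (subst sum.union_disjoint) (auto simp: sum.reindex)
  then show ?thesis
    unfolding mean_def g_def by (simp add: exec_Suc_shift del: exec.simps) (simp add: field_simps)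
qed

text \<open>Quantifying over all later times makes the predicate monotone in \<open>t\<close>, so
  time bounds can be rounded up freely, finally to a polynomial.\<close>

definition good :: "program \<Rightarrow> state \<Rightarrow> nat \<Rightarrow> real \<Rightarrow> bool" where
  "good P s t v \<longleftrightarrow> (\<forall>T\<ge>t. (\<forall>cs. halted P (exec P f n cs T s) \<and>
      card (alg_output n (exec P f n cs T s)) \<le> bound) \<and> v \<le> mean P T s)"

lemma good_mono: "good P s t v \<Longrightarrow> t \<le> t' \<Longrightarrow> v' \<le> v \<Longrightarrow> good P s t' v'"
  unfolding good_def by (meson order.trans)

lemma good_halted:
  assumes "halted P s" "card (alg_output n s) \<le> bound" "v \<le> f (alg_output n s)"
  shows "good P s t v"
proof -
  have st: "step P f n b s = s" for b
    using assms(1) by (simp add: step_def)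
  have ex: "exec P f n cs T s = s" for cs T
    by (induction T) (simp_all add: st)
  have "mean P T s = f (alg_output n s)" for T
    by (induction T) (simp_all add: mean_Suc st)
  then show ?thesis
    using assms by (simp add: good_def ex)
qed

lemma good_step:
  assumes "good P (step P f n True s) t v" "good P (step P f n False s) t w" "u \<le> (v + w) / 2"
  shows "good P s (Suc t) u"
  unfolding good_def
proof (intro allI impI)
  fix T assume "Suc t \<le> T"
  then obtain T' where T: "T = Suc T'" "t \<le> T'"
    by (metis Suc_le_D Suc_le_mono)
  have "halted P (exec P f n cs T' (step P f n b s)) \<and>
      card (alg_output n (exec P f n cs T' (step P f n b s))) \<le> bound" for cs b
    using assms(1,2) T(2) unfolding good_def by (cases b) auto
  moreover have "u \<le> mean P T s"
  proof -
    have "v \<le> mean P T' (step P f n True s)" "w \<le> mean P T' (step P f n False s)"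
      using assms(1,2) T(2) unfolding good_def by auto
    then show ?thesis
      using assms(3) unfolding T(1) mean_Suc by simp
  qed
  ultimately show "(\<forall>cs. halted P (exec P f n cs T s) \<and>
      card (alg_output n (exec P f n cs T s)) \<le> bound) \<and> u \<le> mean P T s"
    unfolding T(1) exec_Suc_shift by blast
qed

lemma good_step_det:
  assumes "p < length P" "P ! p = x" "x \<noteq> Halt"
    and "\<And>b. exec_instr f n b x \<lparr>pc = p, rreg = R, nreg = N\<rparr> = s'"
    and "good P s' t v"
  shows "good P \<lparr>pc = p, rreg = R, nreg = N\<rparr> (Suc t) v"
proof (rule good_step)
  have "step P f n b \<lparr>pc = p, rreg = R, nreg = N\<rparr> = s'" for b
    using assms(1-4) by (simp add: step_def halted_def)
  then show "good P (step P f n True \<lparr>pc = p, rreg = R, nreg = N\<rparr>) t v"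
    "good P (step P f n False \<lparr>pc = p, rreg = R, nreg = N\<rparr>) t v"
    using assms(5) by simp_all
qed simp

section \<open>Straight-line code and a Hoare logic for expected values\<close>

definition sel :: "(nat \<Rightarrow> real) \<Rightarrow> nat \<Rightarrow> nat set" where
  "sel R a = {x. x < n \<and> R (a + x) \<noteq> 0}"

text \<open>The values for jumps, \<open>Coin\<close> and \<open>Halt\<close> are dummies;
  \<open>straight\<close> keeps these instructions out of blocks that are reasoned about.\<close>

primrec prim :: "instr \<Rightarrow> (nat \<Rightarrow> real) \<Rightarrow> (nat \<Rightarrow> nat) \<Rightarrow> (nat \<Rightarrow> real) \<times> (nat \<Rightarrow> nat)" where
  "prim (RConst i c) R N = (R(i := of_int c), N)"
| "prim (RAdd i j k) R N = (R(i := R j + R k), N)"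
| "prim (RSub i j k) R N = (R(i := R j - R k), N)"
| "prim (RMul i j k) R N = (R(i := R j * R k), N)"
| "prim (RDiv i j k) R N = (R(i := R j / R k), N)"
| "prim (RLoad i a) R N = (R(i := R (N a)), N)"
| "prim (RStore a i) R N = (R(N a := R i), N)"
| "prim (NConst a m) R N = (R, N(a := m))"
| "prim (NAdd a b c) R N = (R, N(a := N b + N c))"
| "prim (NSub a b c) R N = (R, N(a := N b - N c))"
| "prim (NtoR i a) R N = (R(i := real (N a)), N)"
| "prim (JmpRLe i j t) R N = (R, N)"
| "prim (JmpNLe a b t) R N = (R, N)"
| "prim (Coin a) R N = (R, N)"
| "prim (Query i a) R N = (R(i := f (sel R (N a))), N)"
| "prim Halt R N = (R, N)"

fun run :: "instr list \<Rightarrow> (nat \<Rightarrow> real) \<Rightarrow> (nat \<Rightarrow> nat) \<Rightarrow> (nat \<Rightarrow> real) \<times> (nat \<Rightarrow> nat)" where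
  "run [] R N = (R, N)"
| "run (x # xs) R N = (case prim x R N of (R', N') \<Rightarrow> run xs R' N')"

lemma run_append: "run (xs @ ys) R N = (case run xs R N of (R', N') \<Rightarrow> run ys R' N')"
  by (induction xs arbitrary: R N) (auto split: prod.splits)

lemma run_replicate_NAdd:
  "a \<noteq> b \<Longrightarrow> run (replicate m (NAdd a a b)) R N = (R, N(a := N a + m * N b))"
  by (induction m arbitrary: N) auto

lemma exec_instr_straight:
  "straight x \<Longrightarrow> exec_instr f n b x \<lparr>pc = p, rreg = R, nreg = N\<rparr> =
    \<lparr>pc = Suc p, rreg = fst (prim x R N), nreg = snd (prim x R N)\<rparr>"
  by (cases x) (simp_all add: exec_instr_def sel_def)

text \<open>Assertions carry, besides the two register files, a lower bound on the expected value of the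
  final output; a coin flip averages these bounds.\<close>

type_synonym assn = "(nat \<Rightarrow> real) \<Rightarrow> (nat \<Rightarrow> nat) \<Rightarrow> real \<Rightarrow> bool"

text \<open>Triples are in continuation style: whatever the rest of \<open>P\<close> achieves from
  the postcondition within \<open>t0\<close> steps is achieved from the precondition within
  \<open>t0 + cost K c\<close>. Thus no distribution over intermediate states is needed.\<close>

definition hoare :: "assn \<Rightarrow> cmd \<Rightarrow> assn \<Rightarrow> bool" where
  "hoare A c A' \<longleftrightarrow> (\<forall>P p R N v t0. placed P p (code c p) \<longrightarrow> A R N v \<longrightarrow>
     (\<forall>R' N' v'. A' R' N' v' \<longrightarrow> good P \<lparr>pc = p + csize c, rreg = R', nreg = N'\<rparr> t0 v') \<longrightarrow>
     good P \<lparr>pc = p, rreg = R, nreg = N\<rparr> (t0 + cost K c) v)"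

lemma hoareD:
  assumes "hoare A c A'" "placed P p (code c p)" "A R N v"
    and "\<And>R' N' v'. A' R' N' v' \<Longrightarrow> good P \<lparr>pc = p + csize c, rreg = R', nreg = N'\<rparr> t0 v'"
  shows "good P \<lparr>pc = p, rreg = R, nreg = N\<rparr> (t0 + cost K c) v"
  using assms unfolding hoare_def by blast

lemma hoare_conseq:
  assumes "hoare A c A'" "\<And>R N v. C R N v \<Longrightarrow> A R N v" "\<And>R N v. A' R N v \<Longrightarrow> C' R N v"
  shows "hoare C c C'"
  using assms unfolding hoare_def by blast

text \<open>Turns an existentially quantified feature of the current state into a constant of the
  triple to be proved.\<close>

lemma hoare_ghost:
  "(\<And>x. \<phi> x \<Longrightarrow> hoare (A x) c A') \<Longrightarrow> hoare (\<lambda>R N v. \<exists>x. \<phi> x \<and> A x R N v) c A'"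
  unfolding hoare_def by blast

lemma hoare_Block:
  assumes "list_all straight xs"
    and "\<And>R N v. A R N v \<Longrightarrow> A' (fst (run xs R N)) (snd (run xs R N)) v"
  shows "hoare A (Block xs) A'"
proof -
  have "good P \<lparr>pc = p, rreg = R, nreg = N\<rparr> (t0 + length xs) v"
    if "placed P p xs" "list_all straight xs"
      "good P \<lparr>pc = p + length xs, rreg = fst (run xs R N), nreg = snd (run xs R N)\<rparr> t0 v"
    for P p R N t0 v
    using that
  proof (induction xs arbitrary: p R N)
    case (Cons x xs)
    obtain R' N' where RN: "prim x R N = (R', N')"
      by fastforce
    have pl: "p < length P" "P ! p = x" "placed P (Suc p) xs"
      using placed_Cons[OF Cons.prems(1)] by auto
    have x: "straight x" "x \<noteq> Halt"
      using Cons.prems(2) by auto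
    have "good P \<lparr>pc = Suc p, rreg = R', nreg = N'\<rparr> (t0 + length xs) v"
      using Cons.IH[of "Suc p" R' N'] pl Cons.prems RN by simp
    then show ?case
      using good_step_det[OF pl(1,2) x(2), of R N] exec_instr_straight[OF x(1)] RN by simp
  qed simp
  then show ?thesis
    unfolding hoare_def using assms by simp
qed

text \<open>The promised value may be split into different promises for the two outcomes. This is
  the only rule in which randomness is visible.\<close>

lemma hoare_Flip:
  assumes "\<And>R N v. A R N v \<Longrightarrow> \<exists>v0 v1. A' R (N(a := 0)) v0 \<and> A' R (N(a := 1)) v1 \<and> v \<le> (v0 + v1) / 2"
  shows "hoare A (Flip a) A'"
  unfolding hoare_def
proof (intro allI impI)
  fix P p R N v t0
  assume pl: "placed P p (code (Flip a) p)" and A: "A R N v"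
    and k: "\<forall>R' N' v'. A' R' N' v' \<longrightarrow> good P \<lparr>pc = p + csize (Flip a), rreg = R', nreg = N'\<rparr> t0 v'"
  have p: "p < length P" "P ! p = Coin a"
    using pl placed_Cons[of P p "Coin a" "[]"] by auto
  obtain v0 v1 where v: "A' R (N(a := 0)) v0" "A' R (N(a := 1)) v1" "v \<le> (v0 + v1) / 2"
    using assms[OF A] by auto
  have "good P \<lparr>pc = p, rreg = R, nreg = N\<rparr> (Suc t0) v"
  proof (rule good_step)
    show "good P (step P f n True \<lparr>pc = p, rreg = R, nreg = N\<rparr>) t0 v1"
      using p k v(2) by (simp add: step_def halted_def exec_instr_def)
    show "good P (step P f n False \<lparr>pc = p, rreg = R, nreg = N\<rparr>) t0 v0"
      using p k v(1) by (simp add: step_def halted_def exec_instr_def)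
    show "v \<le> (v1 + v0) / 2"
      using v(3) by simp
  qed
  then show "good P \<lparr>pc = p, rreg = R, nreg = N\<rparr> (t0 + cost K (Flip a)) v"
    by simp
qed

lemma hoare_Seq:
  assumes "hoare A c A'" "hoare A' d A''"
  shows "hoare A (c ;; d) A''"
  unfolding hoare_def
proof (intro allI impI)
  fix P p R N v t0
  assume pl: "placed P p (code (c ;; d) p)" and A: "A R N v"
    and k: "\<forall>R' N' v'. A'' R' N' v' \<longrightarrow> good P \<lparr>pc = p + csize (c ;; d), rreg = R', nreg = N'\<rparr> t0 v'"
  have pl: "placed P p (code c p)" "placed P (p + csize c) (code d (p + csize c))"
    using placed_append[OF pl[unfolded code.simps]] by auto
  have "good P \<lparr>pc = p + csize c, rreg = R', nreg = N'\<rparr> (t0 + cost K d) v'" if "A' R' N' v'" for R' N' v'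
    using assms(2) pl(2) k that unfolding hoare_def by (simp add: add.assoc)
  then have "good P \<lparr>pc = p, rreg = R, nreg = N\<rparr> (t0 + cost K d + cost K c) v"
    using assms(1) pl(1) A unfolding hoare_def by blast
  then show "good P \<lparr>pc = p, rreg = R, nreg = N\<rparr> (t0 + cost K (c ;; d)) v"
    by (simp add: ac_simps)
qed

lemma hoare_Seq_assoc: "hoare A ((c ;; d) ;; e) A' \<longleftrightarrow> hoare A (c ;; d ;; e) A'"
  unfolding hoare_def by (simp add: add.assoc)

lemma good_cond:
  assumes pl: "placed P p (ins # code d (p + 1) @
      JmpNLe 0 0 (p + csize c + csize d + 2) # code c (p + csize d + 2))"
    and ins: "\<And>b. exec_instr f n b ins \<lparr>pc = p, rreg = R, nreg = N\<rparr> =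
        \<lparr>pc = (if q then p + csize d + 2 else Suc p), rreg = R, nreg = N\<rparr>" "ins \<noteq> Halt"
    and c: "hoare (\<lambda>R N v. A R N v \<and> q) c A'" and d: "hoare (\<lambda>R N v. A R N v \<and> \<not> q) d A'"
    and A: "A R N v"
    and k: "\<forall>R' N' v'. A' R' N' v' \<longrightarrow>
        good P \<lparr>pc = p + (csize c + csize d + 2), rreg = R', nreg = N'\<rparr> t0 v'"
  shows "good P \<lparr>pc = p, rreg = R, nreg = N\<rparr> (t0 + (cost K c + cost K d + 2)) v"
proof -
  have pl1: "p < length P" "P ! p = ins" "placed P (Suc p) (code d (Suc p))"
    "placed P (Suc p + csize d) (JmpNLe 0 0 (p + csize c + csize d + 2) # code c (p + csize d + 2))"
    using placed_Cons[OF pl] placed_append[of P "Suc p" "code d (Suc p)"] by auto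
  have pl2: "Suc p + csize d < length P"
    "P ! (Suc p + csize d) = JmpNLe 0 0 (p + csize c + csize d + 2)"
    "placed P (p + csize d + 2) (code c (p + csize d + 2))"
    using placed_Cons[OF pl1(4)] by auto
  have "good P \<lparr>pc = (if q then p + csize d + 2 else Suc p), rreg = R, nreg = N\<rparr> (t0 + 1 + (cost K c + cost K d)) v"
  proof (cases q)
    case True
    have "good P \<lparr>pc = p + csize d + 2, rreg = R, nreg = N\<rparr> (t0 + cost K c) v"
      by (rule hoareD[OF c pl2(3)]) (use A True k in \<open>auto simp: ac_simps\<close>)
    then have "good P \<lparr>pc = p + csize d + 2, rreg = R, nreg = N\<rparr> (t0 + 1 + (cost K c + cost K d)) v"
      by (rule good_mono) auto
    then show ?thesis
      using True by simp
  next
    case False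
    have "good P \<lparr>pc = Suc p + csize d, rreg = R', nreg = N'\<rparr> (t0 + 1) v'"
      if "A' R' N' v'" for R' N' v'
    proof -
      have "good P \<lparr>pc = p + csize c + csize d + 2, rreg = R', nreg = N'\<rparr> t0 v'"
        using k that by (simp add: ac_simps)
      then show ?thesis
        using good_step_det[OF pl2(1,2)] by (simp add: exec_instr_def)
    qed
    then have "good P \<lparr>pc = Suc p, rreg = R, nreg = N\<rparr> (t0 + 1 + cost K d) v"
      using hoareD[OF d pl1(3), of R N v "t0 + 1"] A False by auto
    then have "good P \<lparr>pc = Suc p, rreg = R, nreg = N\<rparr> (t0 + 1 + (cost K c + cost K d)) v"
      by (rule good_mono) auto
    then show ?thesis
      using False by simp
  qed
  then have "good P \<lparr>pc = p, rreg = R, nreg = N\<rparr> (Suc (t0 + 1 + (cost K c + cost K d))) v"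
    using good_step_det[OF pl1(1,2) ins(2) ins(1)] by blast
  then show ?thesis
    by (simp add: ac_simps)
qed

lemma hoare_IfR:
  assumes "hoare (\<lambda>R N v. A R N v \<and> R i \<le> R j) c A'" "hoare (\<lambda>R N v. A R N v \<and> \<not> R i \<le> R j) d A'"
  shows "hoare A (IfR i j c d) A'"
proof -
  have "good P \<lparr>pc = p, rreg = R, nreg = N\<rparr> (t0 + cost K (IfR i j c d)) v"
    if "placed P p (code (IfR i j c d) p)" "A R N v"
      "\<forall>R' N' v'. A' R' N' v' \<longrightarrow>
        good P \<lparr>pc = p + csize (IfR i j c d), rreg = R', nreg = N'\<rparr> t0 v'" for P p R N v t0
    unfolding cost.simps
  \<comment> \<open>\<open>q\<close> is a fixed truth value; the conjunct \<open>R' = R\<close> ties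
    it to the state in which the test is evaluated.\<close>
  proof (rule good_cond[where A = "\<lambda>R' N' v'. A R' N' v' \<and> R' = R" and q = "R i \<le> R j"
        and ins = "JmpRLe i j (p + csize d + 2)"])
    show "hoare (\<lambda>R' N' v'. (A R' N' v' \<and> R' = R) \<and> R i \<le> R j) c A'"
      by (rule hoare_conseq[OF assms(1)]) auto
    show "hoare (\<lambda>R' N' v'. (A R' N' v' \<and> R' = R) \<and> \<not> R i \<le> R j) d A'"
      by (rule hoare_conseq[OF assms(2)]) auto
  qed (use that in \<open>simp_all add: exec_instr_def\<close>)
  then show ?thesis
    unfolding hoare_def by blast
qed

lemma hoare_IfN:
  assumes "hoare (\<lambda>R N v. A R N v \<and> N i \<le> N j) c A'" "hoare (\<lambda>R N v. A R N v \<and> \<not> N i \<le> N j) d A'"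
  shows "hoare A (IfN i j c d) A'"
proof -
  have "good P \<lparr>pc = p, rreg = R, nreg = N\<rparr> (t0 + cost K (IfN i j c d)) v"
    if "placed P p (code (IfN i j c d) p)" "A R N v"
      "\<forall>R' N' v'. A' R' N' v' \<longrightarrow>
        good P \<lparr>pc = p + csize (IfN i j c d), rreg = R', nreg = N'\<rparr> t0 v'" for P p R N v t0
    unfolding cost.simps
  proof (rule good_cond[where A = "\<lambda>R' N' v'. A R' N' v' \<and> N' = N" and q = "N i \<le> N j"
        and ins = "JmpNLe i j (p + csize d + 2)"])
    show "hoare (\<lambda>R' N' v'. (A R' N' v' \<and> N' = N) \<and> N i \<le> N j) c A'"
      by (rule hoare_conseq[OF assms(1)]) auto
    show "hoare (\<lambda>R' N' v'. (A R' N' v' \<and> N' = N) \<and> \<not> N i \<le> N j) d A'"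
      by (rule hoare_conseq[OF assms(2)]) auto
  qed (use that in \<open>simp_all add: exec_instr_def\<close>)
  then show ?thesis
    unfolding hoare_def by blast
qed

text \<open>The truncated difference \<open>N b - N a\<close> is the variant: it is positive exactly
  when the guard holds, and \<open>len\<close> makes it compatible with
  \<open>cost K\<close>.\<close>

lemma hoare_While:
  assumes body: "\<And>i. hoare (\<lambda>R N v. A R N v \<and> N b - N a = Suc i) c (\<lambda>R N v. A R N v \<and> N b - N a \<le> i)"
    and len: "\<And>R N v. A R N v \<Longrightarrow> N b - N a \<le> K"
  shows "hoare A (While a b c) (\<lambda>R N v. A R N v \<and> N b \<le> N a)"
proof -
  have main: "good P \<lparr>pc = p, rreg = R, nreg = N\<rparr> (t0 + (i * (cost K c + 2) + 1)) v"
    if pl: "placed P p (code (While a b c) p)" and "A R N v" and "N b - N a \<le> i"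
      and k: "\<forall>R' N' v'. A R' N' v' \<and> N' b \<le> N' a \<longrightarrow>
        good P \<lparr>pc = p + csize (While a b c), rreg = R', nreg = N'\<rparr> t0 v'" for P p R N v t0 i
    using that(2,3)
  proof (induction i arbitrary: R N v rule: less_induct)
    case (less i)
    have pl1: "p < length P" "P ! p = JmpNLe b a (p + csize c + 2)" "placed P (Suc p) (code c (Suc p))"
      "placed P (Suc p + csize c) [JmpNLe 0 0 p]"
      using placed_Cons[OF pl[unfolded code.simps]] placed_append[of P "Suc p" "code c (Suc p)"] by auto
    have pl2: "Suc p + csize c < length P" "P ! (Suc p + csize c) = JmpNLe 0 0 p"
      using placed_Cons[OF pl1(4)] by auto
    show ?case
    proof (cases "N b \<le> N a")
      case True
      have "good P \<lparr>pc = p + csize c + 2, rreg = R, nreg = N\<rparr> (t0 + i * (cost K c + 2)) v"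
        by (rule good_mono[of _ _ t0]) (use True k less.prems(1) in \<open>auto simp: ac_simps\<close>)
      then show ?thesis
        using good_step_det[OF pl1(1,2)] True by (simp add: exec_instr_def)
    next
      case False
      then obtain j where j: "N b - N a = Suc j"
        by (metis Suc_diff_Suc not_le)
      then obtain i' where i': "i = Suc i'" "j \<le> i'"
        using less.prems(2) by (metis Suc_le_D Suc_le_mono)
      have next_iter: "good P \<lparr>pc = Suc p + csize c, rreg = R', nreg = N'\<rparr> (t0 + (i' * (cost K c + 2) + 2)) v'"
        if "A R' N' v' \<and> N' b - N' a \<le> j" for R' N' v'
        using less.IH[of i' R' N' v'] that i' good_step_det[OF pl2(1,2)]
        by (simp add: exec_instr_def)
      have "good P \<lparr>pc = Suc p, rreg = R, nreg = N\<rparr> (t0 + (i' * (cost K c + 2) + 2) + cost K c) v"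
        by (rule hoareD[OF body[of j] pl1(3) _ next_iter]) (use less.prems(1) j in auto)
      then have "good P \<lparr>pc = p, rreg = R, nreg = N\<rparr> (Suc (t0 + (i' * (cost K c + 2) + 2) + cost K c)) v"
        using good_step_det[OF pl1(1,2)] False by (simp add: exec_instr_def)
      then show ?thesis
        by (rule good_mono) (simp_all add: i')
    qed
  qed
  show ?thesis
    unfolding hoare_def cost.simps using main len by blast
qed

text \<open>The compiled code ends at position \<open>csize c\<close>, which is beyond the last
  instruction and hence a halted state.\<close>

lemma hoare_program:
  assumes "hoare A c A'" "A R N v"
    and "\<And>R N v. A' R N v \<Longrightarrow>
      card {i. i < n \<and> R i \<noteq> 0} \<le> bound \<and> v \<le> f {i. i < n \<and> R i \<noteq> 0}"
  shows "good (code c 0) \<lparr>pc = 0, rreg = R, nreg = N\<rparr> (cost K c) v"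
proof -
  have "good (code c 0) \<lparr>pc = 0 + csize c, rreg = R', nreg = N'\<rparr> 0 v'" if "A' R' N' v'" for R' N' v'
    using assms(3)[OF that] by (intro good_halted) (simp_all add: halted_def alg_output_def)
  moreover have "placed (code c 0) 0 (code c 0)"
    unfolding placed_def by simp
  ultimately have "good (code c 0) \<lparr>pc = 0, rreg = R, nreg = N\<rparr> (0 + cost K c) v"
    using assms(1,2) unfolding hoare_def by blast
  then show ?thesis
    by simp
qed

text \<open>Meant for loop-free commands, whose triples then follow by simplification; loops go
  through \<open>hoare_While\<close> with an explicit invariant.\<close>

primrec wp :: "cmd \<Rightarrow> assn \<Rightarrow> assn" where
  "wp (Block xs) Q = (\<lambda>R N v. list_all straight xs \<and> (case run xs R N of (R', N') \<Rightarrow> Q R' N' v))"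
| "wp (Flip a) Q = (\<lambda>R N v. \<exists>v0 v1. Q R (N(a := 0)) v0 \<and> Q R (N(a := 1)) v1 \<and> v \<le> (v0 + v1) / 2)"
| "wp (Seq c d) Q = wp c (wp d Q)"
| "wp (IfR i j c d) Q = (\<lambda>R N v. if R i \<le> R j then wp c Q R N v else wp d Q R N v)"
| "wp (IfN i j c d) Q = (\<lambda>R N v. if N i \<le> N j then wp c Q R N v else wp d Q R N v)"
| "wp (While a b c) Q = (\<lambda>R N v. False)"

lemma hoare_wp: "(\<And>R N v. A R N v \<Longrightarrow> wp c Q R N v) \<Longrightarrow> hoare A c Q"
proof (induction c arbitrary: A Q)
  case (Block xs)
  show ?case
  proof (cases "list_all straight xs")
    case True
    then show ?thesis
      using Block by (intro hoare_Block) (simp_all add: case_prod_beta)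
  next
    case False
    then show ?thesis
      using Block unfolding hoare_def by auto
  qed
next
  case (Flip a)
  then show ?case
    unfolding wp.simps by (rule hoare_Flip)
next
  case (Seq c d)
  show ?case
    by (rule hoare_Seq[OF Seq.IH(1)[of A "wp d Q"] Seq.IH(2)]) (use Seq.prems in auto)
next
  case (IfR i j c d)
  show ?case
    by (intro hoare_IfR IfR.IH) (use IfR.prems in \<open>fastforce\<close>)+
next
  case (IfN i j c d)
  show ?case
    by (intro hoare_IfN IfN.IH) (use IfN.prems in \<open>fastforce\<close>)+
next
  case (While a b c)
  have "\<not> A R N v" for R N v
    using While.prems by auto
  then show ?case
    unfolding hoare_def by blast
qed

end

section \<open>The algorithm\<close>

text \<open>Four arrays of length \<open>n\<close> start at real register 40; their base addresses are kept in the nat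
  registers 10 to 13. They hold the labels (array 0, where \<open>u\<close> has label \<open>j\<close> iff \<open>u \<in> D\<^sub>j\<close>), the
  sets \<open>X\<close> and \<open>Y\<close> of the double greedy algorithm, and the best set found so far.\<close>

definition clear :: "nat \<Rightarrow> cmd" where
  "clear a = Block [NConst 2 0] ;; While 2 0 (Block [NAdd 8 (10 + a) 2, RStore 8 2, NAdd 2 2 5])"

text \<open>Nat registers cannot be multiplied, so \<open>6 * k * B\<close> is obtained by
  \<open>6 * k\<close> additions of \<open>B\<close>. Nat register 15 holds the number
  \<open>2 * n\<close> of guesses, and 16 the number \<open>n + k\<close> of fair coins per
  decision.\<close>

definition prepare :: "nat \<Rightarrow> cmd" where
  "prepare k = Block ([NConst 5 1, NConst 18 0, NConst 10 40, NAdd 11 10 0, NAdd 12 11 0, NAdd 13 12 0,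
     NConst 14 k, NAdd 15 0 0, NConst 16 k, NAdd 16 16 0, RConst 1 1, RConst 2 0, RConst 3 0,
     RConst 4 0, NConst 2 0] @ replicate (6 * k) (NAdd 7 7 1))"

definition sum_singletons :: cmd where
  "sum_singletons = While 2 0
     (Block [NAdd 8 11 2, RStore 8 1, Query 5 11, RAdd 4 4 5, RStore 8 2, NAdd 2 2 5])"

text \<open>The sum of singletons becomes the threshold increment \<open>\<sigma>\<close>; the best
  value so far is initialised by the empty set.\<close>

definition scale :: cmd where
  "scale = Block [RConst 5 2, RDiv 4 4 5, NtoR 5 0, RDiv 4 4 5, NtoR 5 14, RDiv 4 4 5,
     NtoR 5 1, RDiv 4 4 5, Query 10 13, NConst 4 0]"

text \<open>Nat registers 3, 4 and 6 hold the number of the pass, the number of the guess and the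
  size of \<open>A\<close>; real registers 3, 4 and 10 hold the threshold, its increment and the
  best value. During a pass, array 1 is the indicator of the set under construction.\<close>

definition build_step :: cmd where
  "build_step = IfN 7 6 (Block [])
     (Block [NAdd 8 10 2, RLoad 0 8] ;;
      IfR 0 2
        (Block [NAdd 8 11 2, Query 5 11, RStore 8 1, Query 6 11, RSub 6 6 5] ;;
         IfR 6 3 (Block [RStore 8 2]) (Block [NAdd 8 10 2, NtoR 5 3, RStore 8 5, NAdd 6 6 5]))
        (Block [])) ;;
     Block [NAdd 2 2 5]"

definition build :: cmd where
  "build = Block [NConst 6 0, NConst 3 0] ;; clear 0 ;;
     While 3 14 (Block [NAdd 3 3 5] ;; clear 1 ;; Block [NConst 2 0] ;; While 2 0 build_step)"

text \<open>Labels are copied as they are, since any nonzero cell means membership; the two nested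
  comparisons test for label \<open>j\<close>.\<close>

definition start :: cmd where
  "start = Block [NConst 2 0, NtoR 7 3] ;; While 2 0
     (Block [NAdd 8 10 2, RLoad 0 8, NAdd 8 12 2, RStore 8 0, NAdd 8 11 2, RStore 8 2] ;;
      IfR 0 7 (IfR 7 0 (Block [RStore 8 0]) (Block [])) (Block []) ;;
      Block [NAdd 2 2 5])"

text \<open>Real register 9 enters as the desired probability and undergoes the random doubling
  behind \<open>bias\<close>; afterwards, being at least 1 means success.\<close>

definition toss :: cmd where
  "toss = Block [NConst 17 0] ;; While 17 16
     (Block [NAdd 17 17 5] ;; Flip 19 ;; Block [NtoR 5 19, RAdd 9 9 9, RSub 9 9 5])"

text \<open>The first comparison skips the elements whose cells in \<open>X\<close> and
  \<open>Y\<close> agree: those outside \<open>A\<close> and those of the starting set. For the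
  others, real registers 6 and 8 receive the gains of adding \<open>u\<close> to \<open>X\<close>
  and of removing it from \<open>Y\<close>.\<close>

definition double_greedy :: cmd where
  "double_greedy = Block [NConst 2 0] ;; While 2 0
     (Block [NAdd 8 11 2, RLoad 5 8, NAdd 9 12 2, RLoad 6 9] ;;
      IfR 6 5 (Block [])
        (Block [RStore 8 1, Query 6 11, RStore 8 2, Query 5 11, RSub 6 6 5,
           Query 7 12, RStore 9 2, Query 8 12, RSub 8 8 7, RAdd 9 6 8, RDiv 9 6 9] ;;
         IfR 8 2 (Block [RConst 9 1]) (Block []) ;;
         toss ;;
         IfR 1 9 (Block [RStore 8 1, RStore 9 1]) (Block [])) ;;
      Block [NAdd 2 2 5])"

definition update :: cmd where
  "update = Block [Query 5 11] ;; IfR 5 10 (Block [])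
     (Block [RAdd 10 5 2, NConst 2 0] ;;
      While 2 0 (Block [NAdd 8 11 2, RLoad 0 8, NAdd 8 13 2, RStore 8 0, NAdd 2 2 5]))"

definition guess_round :: cmd where
  "guess_round = Block [RAdd 3 3 4, NAdd 4 4 5] ;; build ;; Block [NConst 3 0] ;;
     While 3 14 (Block [NAdd 3 3 5] ;; start ;; double_greedy ;; update)"

text \<open>The output occupies the low real registers, including the scratch register 0, so it is copied
  downwards.\<close>

definition copy_best :: cmd where
  "copy_best = Block [NAdd 2 0 18] ;;
     While 18 2 (Block [NSub 2 2 5, NAdd 8 13 2, RLoad 0 8, RStore 2 0])"

definition bicriteria_program :: "nat \<Rightarrow> cmd" where
  "bicriteria_program k = prepare k ;; sum_singletons ;; scale ;; While 4 15 guess_round ;; copy_best"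

section \<open>Memory layout and register invariants\<close>

text \<open>The loops run for \<open>n\<close>, \<open>k\<close>, \<open>n + k\<close> or
  \<open>2 * n\<close> rounds, all within \<open>2 * n + k\<close>. Optimality of \<open>opt\<close>
  enters through \<open>singleton_le\<close>; singletons are feasible only if
  \<open>1 \<le> B\<close>.\<close>

locale bicriteria = oracle_machine f n "6 * k * B" "2 * n + k" for f n k B +
  fixes F :: real and opt :: "nat set"
  assumes sm: "submodular_on {..<n} f" and nn: "nonneg_on {..<n} f" and k: "1 \<le> k"
    and opt: "opt \<subseteq> {..<n}" "card opt \<le> B" "f opt = F"
    and singleton_le: "\<And>x. x < n \<Longrightarrow> 1 \<le> B \<Longrightarrow> f {x} \<le> F"
begin

lemma nonneg: "S \<subseteq> {..<n} \<Longrightarrow> 0 \<le> f S"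
  using nn unfolding nonneg_on_def by blast

definition bs :: "nat \<Rightarrow> nat" where "bs a = 40 + a * n"

lemma bs_eq_iff: "x < n \<Longrightarrow> y < n \<Longrightarrow> bs a + x = bs b + y \<longleftrightarrow> a = b \<and> x = y"
proof -
  assume *: "x < n" "y < n"
  have "a = b" if "bs a + x = bs b + y"
  proof -
    have eq: "a * n + x = b * n + y"
      using that by (simp add: bs_def)
    have "(a * n + x) div n = a" "(b * n + y) div n = b"
      using * by auto
    then show ?thesis
      using eq by simp
  qed
  then show ?thesis
    by auto
qed

lemma bs_inj: "0 < n \<Longrightarrow> bs a = bs b \<longleftrightarrow> a = b"
  by (simp add: bs_def)

lemma bs_noteq [simp]: "i < 40 \<Longrightarrow> bs a + x \<noteq> i" "i < 40 \<Longrightarrow> i \<noteq> bs a + x" "bs a \<noteq> 0"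
  by (auto simp: bs_def)

lemma sel_upd_scalar [simp]: "i < 40 \<Longrightarrow> sel (R(i := y)) (bs a) = sel R (bs a)"
  by (auto simp: sel_def)

lemma sel_upd_cell [simp]:
  "u < n \<Longrightarrow> sel (R(bs b + u := y)) (bs a) =
    (if a = b then if y = 0 then sel R (bs a) - {u} else insert u (sel R (bs a)) else sel R (bs a))"
  by (auto simp: sel_def bs_eq_iff)

definition fixed_regs :: "(nat \<Rightarrow> real) \<Rightarrow> (nat \<Rightarrow> nat) \<Rightarrow> bool" where
  "fixed_regs R N \<longleftrightarrow> N 0 = n \<and> N 1 = B \<and> N 5 = 1 \<and> N 7 = 6 * k * B \<and> N 10 = bs 0 \<and> N 11 = bs 1 \<and>
     N 12 = bs 2 \<and> N 13 = bs 3 \<and> N 14 = k \<and> N 15 = 2 * n \<and> N 16 = n + k \<and> N 18 = 0 \<and>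
     R 1 = 1 \<and> R 2 = 0"

text \<open>Chosen such that \<open>\<sigma> * k * B\<close> is the spacing of the guesses for
  \<open>F\<close>, namely the sum of all singleton values divided by \<open>2 * n\<close>.\<close>

definition \<sigma> :: real where
  "\<sigma> = (\<Sum>x<n. f {x}) / 2 / real n / real k / real B"

definition env :: "real \<Rightarrow> real \<Rightarrow> nat \<Rightarrow> (nat \<Rightarrow> real) \<Rightarrow> (nat \<Rightarrow> nat) \<Rightarrow> bool" where
  "env z \<tau> g R N \<longleftrightarrow> fixed_regs R N \<and> R 10 = z \<and> f (sel R (bs 3)) = z \<and>
     card (sel R (bs 3)) \<le> 6 * k * B \<and> R 3 = \<tau> \<and> R 4 = \<sigma> \<and> N 4 = g"

text \<open>Any \<open>P\<close> that survives zeros in array \<open>a\<close> and changes of the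
  scratch registers is carried along, so the same triple serves the label array and the scratch
  array.\<close>

lemma hoare_clear:
  assumes P: "\<And>R N v x y y'. P R N v \<Longrightarrow> x < n \<Longrightarrow> P (R(bs a + x := 0)) (N(8 := y, 2 := y')) v"
    "\<And>R N v y. P R N v \<Longrightarrow> P R (N(2 := y)) v" "\<And>R N v. P R N v \<Longrightarrow> fixed_regs R N"
    and a: "a < 4"
  shows "hoare P (clear a) (\<lambda>R N v. P R N v \<and> (\<forall>x<n. R (bs a + x) = 0))"
proof -
  define I where "I R N v \<longleftrightarrow> P R N v \<and> N 2 \<le> n \<and> (\<forall>x<N 2. R (bs a + x) = 0)" for R N v
  have addr: "N (10 + a) = bs a" if "fixed_regs R N" for R N
    using that a unfolding fixed_regs_def
    by (auto simp: less_Suc_eq numeral_eq_Suc)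
  have "hoare P (Block [NConst 2 0]) I"
    using P(2) by (intro hoare_wp) (auto simp: I_def)
  moreover have "hoare I (While 2 0 (Block [NAdd 8 (10 + a) 2, RStore 8 2, NAdd 2 2 5]))
      (\<lambda>R N v. I R N v \<and> N 0 \<le> N 2)"
  proof (rule hoare_While)
    fix i
    show "hoare (\<lambda>R N v. I R N v \<and> N 0 - N 2 = Suc i) (Block [NAdd 8 (10 + a) 2, RStore 8 2, NAdd 2 2 5])
        (\<lambda>R N v. I R N v \<and> N 0 - N 2 \<le> i)"
    proof (rule hoare_wp, elim conjE)
      fix R N v
      assume I: "I R N v" and i: "N 0 - N 2 = Suc i"
      have c: "fixed_regs R N"
        using I P(3) by (auto simp: I_def)
      then have c': "N 0 = n" "N 5 = 1" "R 2 = 0"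
        by (auto simp: fixed_regs_def)
      have lt: "N 2 < n"
        using i c' by simp
      have "P (R(bs a + N 2 := 0)) (N(8 := bs a + N 2, 2 := Suc (N 2))) v"
        using I lt by (intro P(1)) (auto simp: I_def)
      then show "wp (Block [NAdd 8 (10 + a) 2, RStore 8 2, NAdd 2 2 5])
          (\<lambda>R N v. I R N v \<and> N 0 - N 2 \<le> i) R N v"
        using I i lt c' addr[OF c] by (auto simp: I_def less_Suc_eq bs_eq_iff)
    qed
  qed (use P(3) in \<open>auto simp: I_def fixed_regs_def\<close>)
  ultimately have "hoare P (clear a) (\<lambda>R N v. I R N v \<and> N 0 \<le> N 2)"
    unfolding clear_def by (rule hoare_Seq)
  then show ?thesis
    by (rule hoare_conseq) (use P(3) in \<open>auto simp: I_def fixed_regs_def\<close>)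
qed

section \<open>Building the disjoint sets\<close>

definition D :: "(nat \<Rightarrow> nat) \<Rightarrow> nat \<Rightarrow> nat set" where "D l j = {x. x < n \<and> l x = j}"

definition A :: "(nat \<Rightarrow> nat) \<Rightarrow> nat set" where "A l = {x. x < n \<and> l x \<noteq> 0}"

definition labels :: "(nat \<Rightarrow> nat) \<Rightarrow> (nat \<Rightarrow> real) \<Rightarrow> bool" where
  "labels l R \<longleftrightarrow> (\<forall>x<n. R (bs 0 + x) = real (l x))"

definition small :: "real \<Rightarrow> (nat \<Rightarrow> nat) \<Rightarrow> nat \<Rightarrow> nat \<Rightarrow> bool" where
  "small \<tau> l j x \<longleftrightarrow> (l x = 0 \<longrightarrow> f (insert x (D l j)) - f (D l j) \<le> \<tau>)"

definition sound :: "real \<Rightarrow> nat \<Rightarrow> (nat \<Rightarrow> nat) \<Rightarrow> bool" where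
  "sound \<tau> j l \<longleftrightarrow> (\<forall>x<n. l x \<le> j) \<and> card (A l) \<le> 6 * k * B \<and>
     (\<forall>i\<ge>1. \<tau> * card (D l i) \<le> f (D l i))"

text \<open>Passes up to \<open>J\<close> are complete, and \<open>Suc J\<close> is the pass in
  which the size limit is noticed. This is the second alternative of
  \<open>exists_good_start_cases\<close>.\<close>

definition full :: "real \<Rightarrow> nat \<Rightarrow> (nat \<Rightarrow> nat) \<Rightarrow> bool" where
  "full \<tau> j l \<longleftrightarrow> card (A l) = 6 * k * B \<and>
     (\<exists>J<j. (\<forall>i\<in>{1..J}. \<forall>x<n. small \<tau> l i x) \<and> (\<forall>x<n. l x \<le> Suc J))"

definition built :: "real \<Rightarrow> nat \<Rightarrow> (nat \<Rightarrow> nat) \<Rightarrow> bool" where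
  "built \<tau> j l \<longleftrightarrow> sound \<tau> j l \<and> ((\<forall>i\<in>{1..j}. \<forall>x<n. small \<tau> l i x) \<or> full \<tau> j l)"

definition building :: "real \<Rightarrow> nat \<Rightarrow> nat \<Rightarrow> (nat \<Rightarrow> nat) \<Rightarrow> bool" where
  "building \<tau> j u l \<longleftrightarrow> 1 \<le> j \<and> sound \<tau> j l \<and>
     ((\<forall>i\<in>{1..<j}. \<forall>x<n. small \<tau> l i x) \<and> (\<forall>x<u. small \<tau> l j x) \<or> full \<tau> j l)"

lemma D_subset: "D l j \<subseteq> {..<n}" and A_subset: "A l \<subseteq> {..<n}"
  by (auto simp: D_def A_def)

lemma built_0: "built \<tau> 0 (\<lambda>_. 0)"
  by (auto simp: built_def sound_def A_def D_def nonneg)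

lemma building_start: "built \<tau> j l \<Longrightarrow> building \<tau> (Suc j) 0 l"
  unfolding built_def building_def sound_def full_def
  by (auto simp: atLeastLessThanSuc_atLeastAtMost less_Suc_eq intro: le_SucI)

lemma building_end:
  assumes "building \<tau> j n l"
  shows "built \<tau> j l"
proof -
  have "small \<tau> l i x"
    if "\<forall>i\<in>{1..<j}. \<forall>x<n. small \<tau> l i x" "\<forall>x<n. small \<tau> l j x" "i \<in> {1..j}" "x < n" for i x
    using that by (cases "i = j") auto
  then show ?thesis
    using assms unfolding built_def building_def by blast
qed

text \<open>If the limit has not been noticed before pass \<open>j\<close>, then
  \<open>j - 1\<close> is the number of complete passes.\<close>

lemma building_full:
  assumes "building \<tau> j u l" "6 * k * B \<le> card (A l)"
  shows "building \<tau> j (Suc u) l"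
proof -
  have s: "1 \<le> j" "sound \<tau> j l" "card (A l) = 6 * k * B"
    using assms by (auto simp: building_def sound_def)
  have "full \<tau> j l"
  proof (cases "full \<tau> j l")
    case False
    then have "\<forall>i\<in>{1..j - 1}. \<forall>x<n. small \<tau> l i x"
      using assms(1) by (auto simp: building_def)
    moreover have "j - 1 < j" "\<forall>x<n. l x \<le> Suc (j - 1)"
      using s by (auto simp: sound_def)
    ultimately show ?thesis
      unfolding full_def using s(3) by blast
  qed
  then show ?thesis
    using s by (simp add: building_def)
qed

lemma building_skip: "building \<tau> j u l \<Longrightarrow> small \<tau> l j u \<Longrightarrow> building \<tau> j (Suc u) l"
  unfolding building_def by (auto simp: less_Suc_eq)

lemma A_upd: "u < n \<Longrightarrow> 1 \<le> j \<Longrightarrow> A (l(u := j)) = insert u (A l)"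
  by (auto simp: A_def)

lemma D_upd: "u < n \<Longrightarrow> D (l(u := j)) j = insert u (D l j)"
  by (auto simp: D_def)

lemma card_A_upd: "u < n \<Longrightarrow> 1 \<le> j \<Longrightarrow> l u = 0 \<Longrightarrow> card (A (l(u := j))) = Suc (card (A l))"
  unfolding A_upd by (subst card_insert_disjoint) (auto simp: A_def)

text \<open>The other sets keep their value. Elements of pass \<open>j\<close> that were rejected
  before \<open>u\<close> stay rejected, as their gain can only shrink when \<open>u\<close> joins
  the set, and \<open>u\<close> itself is now labelled.\<close>

lemma building_add:
  assumes b: "building \<tau> j u l" and u: "u < n" "l u = 0" and lt: "card (A l) < 6 * k * B"
    and gain: "\<tau> < f (insert u (D l j)) - f (D l j)"
  shows "building \<tau> j (Suc u) (l(u := j))"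
proof -
  let ?l = "l(u := j)"
  \<comment> \<open>By \<open>lt\<close> the set \<open>A\<close> is below its limit, which excludes
    the alternative \<open>full\<close>.\<close>
  have s: "1 \<le> j" "sound \<tau> j l" "\<And>i x. i \<in> {1..<j} \<Longrightarrow> x < n \<Longrightarrow> small \<tau> l i x"
    "\<And>x. x < u \<Longrightarrow> small \<tau> l j x"
    using b lt by (auto simp: building_def full_def)
  have D_other: "D ?l i = D l i" if "1 \<le> i" "i \<noteq> j" for i
    using that u by (auto simp: D_def)
  have uD: "u \<notin> D l j" and finD: "finite (D l j)"
    using u s(1) by (auto simp: D_def)
  have "\<tau> * card (D ?l i) \<le> f (D ?l i)" if "1 \<le> i" for i
  proof (cases "i = j")
    case True
    have "\<tau> * card (D l j) \<le> f (D l j)"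
      using s(1,2) by (auto simp: sound_def)
    then show ?thesis
      using gain uD finD u unfolding True D_upd[OF u(1)] by (simp add: algebra_simps)
  next
    case False
    then show ?thesis
      using D_other[OF that] s(2) that by (auto simp: sound_def)
  qed
  moreover have "card (A ?l) \<le> 6 * k * B"
    using card_A_upd[of u j l] u s(1) lt by simp
  ultimately have "sound \<tau> j ?l"
    using s(2) by (auto simp: sound_def)
  moreover have "small \<tau> ?l i x" if "i \<in> {1..<j}" "x < n" for i x
    using s(3)[OF that] D_other[of i] that s(1) by (auto simp: small_def)
  moreover have "small \<tau> ?l j x" if "x < Suc u" for x
  proof (cases "x = u \<or> l x \<noteq> 0")
    case True
    then show ?thesis
      using s(1) by (auto simp: small_def)
  next
    case False
    then have x: "x < u" "l x = 0"
      using that by auto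
    have "f (insert x (insert u (D l j))) - f (insert u (D l j)) \<le> f (insert x (D l j)) - f (D l j)"
      using x u s(1) D_subset by (intro submodular_on_insert[OF sm]) (auto simp: D_def)
    then show ?thesis
      using s(4)[OF x(1)] x unfolding small_def D_upd[OF u(1)] by auto
  qed
  ultimately show ?thesis
    using s(1) unfolding building_def by blast
qed

lemma hoare_build_step:
  fixes z \<tau> w g j
  defines "I \<equiv> (\<lambda>R N v. env z \<tau> g R N \<and> v = w \<and> N 3 = j \<and> N 2 \<le> n \<and>
    (\<exists>l. labels l R \<and> building \<tau> j (N 2) l \<and> sel R (bs 1) = D l j \<and> N 6 = card (A l)))"
  shows "hoare (\<lambda>R N v. I R N v \<and> N 0 - N 2 = Suc i) build_step (\<lambda>R N v. I R N v \<and> N 0 - N 2 \<le> i)"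
proof (rule hoare_wp, elim conjE)
  fix R N v
  assume I: "I R N v" and i: "N 0 - N 2 = Suc i"
  obtain l where l: "labels l R" "building \<tau> j (N 2) l" "sel R (bs 1) = D l j" "N 6 = card (A l)"
    using I by (auto simp: I_def)
  have c: "N 0 = n" "N 5 = 1" "N 7 = 6 * k * B" "N 10 = bs 0" "N 11 = bs 1" "R 1 = 1" "R 2 = 0" "R 3 = \<tau>"
    "N 3 = j"
    using I by (auto simp: I_def env_def fixed_regs_def)
  define u where "u = N 2"
  have u: "N 2 = u" "u < n" "n - u = Suc i"
    using i c by (auto simp: u_def)
  note l2 = l(2)[unfolded u(1)]
  have j: "1 \<le> j"
    using l2 by (simp add: building_def)
  have lu: "R (bs 0 + u) = real (l u)"
    using l(1) u by (simp add: labels_def)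
  show "wp build_step (\<lambda>R N v. I R N v \<and> N 0 - N 2 \<le> i) R N v"
  proof (cases "6 * k * B \<le> card (A l)")
    case True
    then show ?thesis
      using I i c u l building_full[OF l2]
      by (auto simp: build_step_def I_def env_def fixed_regs_def)
  next
    case not_full: False
    show ?thesis
    proof (cases "l u = 0")
      case False
      then have "building \<tau> j (Suc u) l"
        by (intro building_skip[OF l2]) (simp add: small_def)
      then show ?thesis
        using I i c u l False not_full lu
        by (auto simp: build_step_def I_def env_def fixed_regs_def labels_def)
    next
      case True
      have uD: "u \<notin> D l j"
        using True j by (auto simp: D_def)
      show ?thesis
      proof (cases "f (insert u (D l j)) - f (D l j) \<le> \<tau>")
        case le: True
        then have "building \<tau> j (Suc u) l"
          by (intro building_skip[OF l2]) (simp add: small_def)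
        then show ?thesis
          using I i c u l True not_full lu le uD
          by (auto simp: build_step_def I_def env_def fixed_regs_def labels_def bs_eq_iff)
      next
        case gt: False
        then have "building \<tau> j (Suc u) (l(u := j))"
          using u True not_full by (intro building_add[OF l2]) auto
        then show ?thesis
          using I i c u l True not_full lu gt uD card_A_upd[of u j l, OF u(2) j True] D_upd[OF u(2)]
          by (auto simp: build_step_def I_def env_def fixed_regs_def labels_def bs_eq_iff
              intro!: exI[of _ "l(u := j)"])
      qed
    qed
  qed
qed

lemma hoare_build:
  "hoare (\<lambda>R N v. env z \<tau> g R N \<and> v = w) build
     (\<lambda>R N v. env z \<tau> g R N \<and> v = w \<and> (\<exists>l. labels l R \<and> built \<tau> k l))"
proof -
  define P0 where "P0 R N v \<longleftrightarrow> env z \<tau> g R N \<and> v = w \<and> N 6 = 0 \<and> N 3 = 0" for R N and v :: real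
  define I where "I R N v \<longleftrightarrow> env z \<tau> g R N \<and> v = w \<and> N 3 \<le> k \<and>
    (\<exists>l. labels l R \<and> built \<tau> (N 3) l \<and> N 6 = card (A l))" for R N and v :: real
  \<comment> \<open>Here \<open>i\<close> passes follow the current one, whose number is therefore
    \<open>k - i\<close>; \<open>i < k\<close> keeps this number positive.\<close>
  define P1 where "P1 i R N v \<longleftrightarrow> env z \<tau> g R N \<and> v = w \<and> i < k \<and> N 3 = k - i \<and>
    (\<exists>l. labels l R \<and> building \<tau> (N 3) 0 l \<and> D l (N 3) = {} \<and> N 6 = card (A l))" for i R N and v :: real
  define I1 where "I1 j R N v \<longleftrightarrow> env z \<tau> g R N \<and> v = w \<and> N 3 = j \<and> N 2 \<le> n \<and>
    (\<exists>l. labels l R \<and> building \<tau> j (N 2) l \<and> sel R (bs 1) = D l j \<and> N 6 = card (A l))" for j R N and v :: real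
  have "hoare (\<lambda>R N v. env z \<tau> g R N \<and> v = w) (Block [NConst 6 0, NConst 3 0]) P0"
    by (rule hoare_wp) (auto simp: P0_def env_def fixed_regs_def)
  moreover have "hoare P0 (clear 0) (\<lambda>R N v. P0 R N v \<and> (\<forall>x<n. R (bs 0 + x) = 0))"
    by (rule hoare_clear) (auto simp: P0_def env_def fixed_regs_def)
  moreover have "hoare (\<lambda>R N v. P0 R N v \<and> (\<forall>x<n. R (bs 0 + x) = 0))
      (While 3 14 (Block [NAdd 3 3 5] ;; clear 1 ;; Block [NConst 2 0] ;; While 2 0 build_step))
      (\<lambda>R N v. I R N v \<and> N 14 \<le> N 3)"
  proof (rule hoare_conseq)
    show "hoare I (While 3 14 (Block [NAdd 3 3 5] ;; clear 1 ;; Block [NConst 2 0] ;; While 2 0 build_step))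
      (\<lambda>R N v. I R N v \<and> N 14 \<le> N 3)"
    proof (rule hoare_While)
      fix i
      have "hoare (\<lambda>R N v. I R N v \<and> N 14 - N 3 = Suc i) (Block [NAdd 3 3 5]) (P1 i)"
      proof (rule hoare_wp, elim conjE)
        fix R N v
        assume I: "I R N v" and i: "N 14 - N 3 = Suc i"
        obtain l where l: "labels l R" "built \<tau> (N 3) l" "N 6 = card (A l)"
          using I by (auto simp: I_def)
        have "D l (Suc (N 3)) = {}"
          using l(2) by (auto simp: built_def sound_def D_def)
        moreover have "N 14 = k" "N 5 = 1"
          using I by (auto simp: I_def env_def fixed_regs_def)
        ultimately show "wp (Block [NAdd 3 3 5]) (P1 i) R N v"
          using I i l building_start[OF l(2)] by (auto simp: I_def P1_def env_def fixed_regs_def)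
      qed
      moreover have "hoare (P1 i) (clear 1) (\<lambda>R N v. P1 i R N v \<and> (\<forall>x<n. R (bs 1 + x) = 0))"
        by (rule hoare_clear) (auto simp: P1_def env_def fixed_regs_def labels_def bs_eq_iff)
      moreover have "hoare (\<lambda>R N v. P1 i R N v \<and> (\<forall>x<n. R (bs 1 + x) = 0)) (Block [NConst 2 0])
          (\<lambda>R N v. I1 (k - i) R N v \<and> i < k)"
        by (rule hoare_wp) (auto simp: P1_def I1_def env_def fixed_regs_def sel_def)
      moreover have "hoare (\<lambda>R N v. I1 (k - i) R N v \<and> i < k) (While 2 0 build_step)
          (\<lambda>R N v. (I1 (k - i) R N v \<and> i < k) \<and> N 0 \<le> N 2)"
      proof (rule hoare_While)
        fix i'
        show "hoare (\<lambda>R N v. (I1 (k - i) R N v \<and> i < k) \<and> N 0 - N 2 = Suc i') build_step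
            (\<lambda>R N v. (I1 (k - i) R N v \<and> i < k) \<and> N 0 - N 2 \<le> i')"
        proof (cases "i < k")
          case True
          then show ?thesis
            using hoare_build_step[of z \<tau> g w "k - i" i'] unfolding I1_def by simp
        next
          case False
          then show ?thesis
            unfolding hoare_def by simp
        qed
      qed (auto simp: I1_def env_def fixed_regs_def)
      ultimately have "hoare (\<lambda>R N v. I R N v \<and> N 14 - N 3 = Suc i)
          (Block [NAdd 3 3 5] ;; clear 1 ;; Block [NConst 2 0] ;; While 2 0 build_step)
          (\<lambda>R N v. (I1 (k - i) R N v \<and> i < k) \<and> N 0 \<le> N 2)"
        by (intro hoare_Seq)
      then show "hoare (\<lambda>R N v. I R N v \<and> N 14 - N 3 = Suc i)
          (Block [NAdd 3 3 5] ;; clear 1 ;; Block [NConst 2 0] ;; While 2 0 build_step)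
          (\<lambda>R N v. I R N v \<and> N 14 - N 3 \<le> i)"
      proof (rule hoare_conseq)
        fix R N v
        assume *: "(I1 (k - i) R N v \<and> i < k) \<and> N 0 \<le> N 2"
        then obtain l where l: "labels l R" "building \<tau> (k - i) (N 2) l" "N 6 = card (A l)"
          by (auto simp: I1_def)
        moreover have "N 2 = n" "N 14 = k" "N 3 = k - i"
          using * by (auto simp: I1_def env_def fixed_regs_def)
        ultimately show "I R N v \<and> N 14 - N 3 \<le> i"
          using * building_end[of \<tau> "k - i" l] by (auto simp: I_def I1_def)
      qed
    qed (auto simp: I_def env_def fixed_regs_def)
  next
    fix R N v
    assume "P0 R N v \<and> (\<forall>x<n. R (bs 0 + x) = 0)"
    then show "I R N v"
      using built_0[of \<tau>] by (auto simp: I_def P0_def labels_def A_def intro!: exI[of _ "\<lambda>_. 0"])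
  qed
  ultimately have "hoare (\<lambda>R N v. env z \<tau> g R N \<and> v = w) build (\<lambda>R N v. I R N v \<and> N 14 \<le> N 3)"
    unfolding build_def by (intro hoare_Seq)
  then show ?thesis
    by (rule hoare_conseq) (auto simp: I_def env_def fixed_regs_def)
qed

section \<open>Double greedy on the machine\<close>

text \<open>The set \<open>Y\<close> of double greedy once the elements below \<open>u\<close> are
  decided. It agrees with \<open>X\<close> there and still contains every undecided element, so it
  is determined by \<open>X\<close>.\<close>

definition upper :: "(nat \<Rightarrow> nat) \<Rightarrow> nat \<Rightarrow> nat set \<Rightarrow> nat set" where
  "upper l u X = X \<union> {x \<in> A l. u \<le> x}"

definition cells :: "(nat \<Rightarrow> nat) \<Rightarrow> nat \<Rightarrow> nat \<Rightarrow> (nat \<Rightarrow> real) \<Rightarrow> bool" where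
  "cells l j u R \<longleftrightarrow> (\<forall>x<n. u \<le> x \<longrightarrow>
     R (bs 1 + x) = (if l x = j then real j else 0) \<and> R (bs 2 + x) = real (l x))"

definition frame :: "real \<Rightarrow> real \<Rightarrow> nat \<Rightarrow> (nat \<Rightarrow> nat) \<Rightarrow> nat \<Rightarrow> (nat \<Rightarrow> real) \<Rightarrow> (nat \<Rightarrow> nat) \<Rightarrow> bool" where
  "frame z \<tau> g l j R N \<longleftrightarrow> env z \<tau> g R N \<and> labels l R \<and> N 3 = j \<and> 1 \<le> j"

lemma hoare_start:
  "hoare (\<lambda>R N v. frame z \<tau> g l j R N \<and> v = w) start
     (\<lambda>R N v. frame z \<tau> g l j R N \<and> v = w \<and> cells l j 0 R)"
proof -
  define I where "I R N v \<longleftrightarrow> frame z \<tau> g l j R N \<and> v = w \<and> R 7 = real j \<and> N 2 \<le> n \<and>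
    (\<forall>x<N 2. R (bs 1 + x) = (if l x = j then real j else 0) \<and> R (bs 2 + x) = real (l x))"
    for R N and v :: real
  have "hoare (\<lambda>R N v. frame z \<tau> g l j R N \<and> v = w) (Block [NConst 2 0, NtoR 7 3]) I"
    by (rule hoare_wp) (auto simp: I_def frame_def env_def fixed_regs_def labels_def)
  moreover have "hoare I (While 2 0
     (Block [NAdd 8 10 2, RLoad 0 8, NAdd 8 12 2, RStore 8 0, NAdd 8 11 2, RStore 8 2] ;;
      IfR 0 7 (IfR 7 0 (Block [RStore 8 0]) (Block [])) (Block []) ;;
      Block [NAdd 2 2 5])) (\<lambda>R N v. I R N v \<and> N 0 \<le> N 2)"
  proof (rule hoare_While)
    fix i
    show "hoare (\<lambda>R N v. I R N v \<and> N 0 - N 2 = Suc i)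
     (Block [NAdd 8 10 2, RLoad 0 8, NAdd 8 12 2, RStore 8 0, NAdd 8 11 2, RStore 8 2] ;;
      IfR 0 7 (IfR 7 0 (Block [RStore 8 0]) (Block [])) (Block []) ;;
      Block [NAdd 2 2 5]) (\<lambda>R N v. I R N v \<and> N 0 - N 2 \<le> i)"
    proof (rule hoare_wp, elim conjE)
      fix R N v
      assume I: "I R N v" and i: "N 0 - N 2 = Suc i"
      have u: "N 2 < n" "0 < n"
        using I i by (auto simp: I_def frame_def env_def fixed_regs_def)
      then have "R (bs 0 + N 2) = real (l (N 2))"
        using I by (auto simp: I_def frame_def labels_def)
      then show "wp (Block [NAdd 8 10 2, RLoad 0 8, NAdd 8 12 2, RStore 8 0, NAdd 8 11 2, RStore 8 2] ;;
          IfR 0 7 (IfR 7 0 (Block [RStore 8 0]) (Block [])) (Block []) ;;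
          Block [NAdd 2 2 5]) (\<lambda>R N v. I R N v \<and> N 0 - N 2 \<le> i) R N v"
        using I i u
        by (simp add: I_def frame_def env_def fixed_regs_def labels_def bs_eq_iff bs_inj less_Suc_eq)
    qed
  qed (auto simp: I_def frame_def env_def fixed_regs_def)
  ultimately have "hoare (\<lambda>R N v. frame z \<tau> g l j R N \<and> v = w) start (\<lambda>R N v. I R N v \<and> N 0 \<le> N 2)"
    unfolding start_def by (rule hoare_Seq)
  then show ?thesis
    by (rule hoare_conseq) (auto simp: I_def cells_def frame_def env_def fixed_regs_def)
qed

text \<open>The invariant promises the interpolation between \<open>vr\<close> and \<open>va\<close>
  with weight \<open>bias\<close> of the remaining rounds. A flip averages it by the recursion of
  \<open>bias\<close>, and with no rounds left the weight is 0 or 1.\<close>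

lemma hoare_toss:
  assumes P: "\<And>R N x y a b. P R N \<Longrightarrow> P (R(5 := x, 9 := y)) (N(17 := a, 19 := b))"
    "\<And>R N a. P R N \<Longrightarrow> P R (N(17 := a))" "\<And>R N. P R N \<Longrightarrow> fixed_regs R N"
  shows "hoare (\<lambda>R N v. P R N \<and> v \<le> vr + bias (n + k) (R 9) * (va - vr)) toss
    (\<lambda>R N v. P R N \<and> v \<le> (if 1 \<le> R 9 then va else vr))"
proof -
  define I where "I R N v \<longleftrightarrow> P R N \<and> N 17 \<le> n + k \<and> v \<le> vr + bias (n + k - N 17) (R 9) * (va - vr)"
    for R N v
  have "hoare (\<lambda>R N v. P R N \<and> v \<le> vr + bias (n + k) (R 9) * (va - vr)) (Block [NConst 17 0]) I"
    by (rule hoare_wp) (auto simp: I_def P(2))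
  moreover have "hoare I (While 17 16
     (Block [NAdd 17 17 5] ;; Flip 19 ;; Block [NtoR 5 19, RAdd 9 9 9, RSub 9 9 5]))
     (\<lambda>R N v. I R N v \<and> N 16 \<le> N 17)"
  proof (rule hoare_While)
    fix i
    show "hoare (\<lambda>R N v. I R N v \<and> N 16 - N 17 = Suc i)
      (Block [NAdd 17 17 5] ;; Flip 19 ;; Block [NtoR 5 19, RAdd 9 9 9, RSub 9 9 5])
      (\<lambda>R N v. I R N v \<and> N 16 - N 17 \<le> i)"
    proof (rule hoare_wp, elim conjE)
      fix R N v
      assume I: "I R N v" and i: "N 16 - N 17 = Suc i"
      have c: "N 16 = n + k" "N 5 = 1"
        using I P(3) by (auto simp: I_def fixed_regs_def)
      have i': "n + k - N 17 = Suc i" "n + k - Suc (N 17) = i" "Suc (N 17) \<le> n + k"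
        using i c by auto
      have "P (R(5 := x, 9 := y)) (N(17 := a, 19 := b))" for x y a b
        using I P(1) by (simp add: I_def)
      moreover define w0 w1 where "w0 = vr + bias i (2 * R 9) * (va - vr)"
        and "w1 = vr + bias i (2 * R 9 - 1) * (va - vr)"
      ultimately have
        "I (R(5 := 0, 9 := 2 * R 9)) (N(17 := Suc (N 17), 19 := 0)) w0"
        "I (R(5 := 1, 9 := 2 * R 9 - 1)) (N(17 := Suc (N 17), 19 := 1)) w1"
        using i' by (auto simp: I_def)
      moreover have "v \<le> (w0 + w1) / 2"
        using I i' by (simp add: I_def w0_def w1_def field_simps)
      ultimately show "wp (Block [NAdd 17 17 5] ;; Flip 19 ;; Block [NtoR 5 19, RAdd 9 9 9, RSub 9 9 5])
          (\<lambda>R N v. I R N v \<and> N 16 - N 17 \<le> i) R N v"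
        using i' c by (simp add: mult_2[symmetric]) blast
    qed
  next
    fix R N v
    assume "I R N v"
    then have "fixed_regs R N"
      using P(3) by (simp add: I_def)
    then show "N 16 - N 17 \<le> 2 * n + k"
      by (simp add: fixed_regs_def)
  qed
  ultimately have "hoare (\<lambda>R N v. P R N \<and> v \<le> vr + bias (n + k) (R 9) * (va - vr)) toss
      (\<lambda>R N v. I R N v \<and> N 16 \<le> N 17)"
    unfolding toss_def by (rule hoare_Seq)
  then show ?thesis
  proof (rule hoare_conseq)
    fix R N v
    assume I: "I R N v \<and> N 16 \<le> N 17"
    then have "N 17 = n + k"
      using P(3)[of R N] by (simp add: I_def fixed_regs_def)
    then show "P R N \<and> v \<le> (if 1 \<le> R 9 then va else vr)"
      using I by (simp add: I_def split: if_splits)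
  qed
qed

text \<open>\<open>V u X\<close> is the value promised when the elements below \<open>u\<close> are
  decided and \<open>X\<close> is the lower set. It stays abstract because a good starting set needs
  the potential of the analysis, whereas for all others a constant promise is passed
  through.\<close>

lemma hoare_double_greedy:
  assumes skip: "\<And>u X. u < n \<Longrightarrow> X \<subseteq> A l \<Longrightarrow> l u = 0 \<or> u \<in> X \<Longrightarrow> V u X \<le> V (Suc u) X"
    and step: "\<And>u X Y a b. u < n \<Longrightarrow> X \<subseteq> A l \<Longrightarrow> l u \<noteq> 0 \<Longrightarrow> u \<notin> X \<Longrightarrow> Y = upper l (Suc u) X \<Longrightarrow>
      a = f (insert u X) - f X \<Longrightarrow> b = f Y - f (insert u Y) \<Longrightarrow>
      V u X \<le> V (Suc u) X + bias (n + k) (if b \<le> 0 then 1 else a / (a + b)) *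
        (V (Suc u) (insert u X) - V (Suc u) X)"
  shows "hoare (\<lambda>R N v. frame z \<tau> g l j R N \<and> cells l j 0 R \<and> v \<le> V 0 (D l j)) double_greedy
    (\<lambda>R N v. frame z \<tau> g l j R N \<and> sel R (bs 1) \<subseteq> A l \<and> v \<le> V n (sel R (bs 1)))"
proof -
  define G where "G m R N v \<longleftrightarrow> frame z \<tau> g l j R N \<and> cells l j m R \<and> sel R (bs 1) \<subseteq> A l \<and>
    sel R (bs 2) = upper l m (sel R (bs 1)) \<and> v \<le> V m (sel R (bs 1))" for m R N v
  define I where "I R N v \<longleftrightarrow> G (N 2) R N v \<and> N 2 \<le> n" for R N v
  define M1 where "M1 i R N v \<longleftrightarrow> G (N 2) R N v \<and> n - N 2 = Suc i \<and> N 8 = bs 1 + N 2 \<and>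
    N 9 = bs 2 + N 2 \<and> R 5 = R (bs 1 + N 2) \<and> R 6 = R (bs 2 + N 2)" for i R N v
  define M2 where "M2 i R N v \<longleftrightarrow> G (Suc (N 2)) R N v \<and> n - N 2 = Suc i" for i R N v
  define P where "P i u X R N \<longleftrightarrow> frame z \<tau> g l j R N \<and> cells l j (Suc u) R \<and> N 2 = u \<and> n - u = Suc i \<and>
    N 8 = bs 1 + u \<and> N 9 = bs 2 + u \<and> sel R (bs 1) = X \<and> sel R (bs 2) = upper l (Suc u) X \<and>
    X \<subseteq> A l \<and> u \<in> A l" for i u X R N
  let ?eval = "Block [RStore 8 1, Query 6 11, RStore 8 2, Query 5 11, RSub 6 6 5,
    Query 7 12, RStore 9 2, Query 8 12, RSub 8 8 7, RAdd 9 6 8, RDiv 9 6 9] ;;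
    IfR 8 2 (Block [RConst 9 1]) (Block [])"
  let ?accept = "IfR 1 9 (Block [RStore 8 1, RStore 9 1]) (Block [])"
  let ?process = "Block [RStore 8 1, Query 6 11, RStore 8 2, Query 5 11, RSub 6 6 5,
    Query 7 12, RStore 9 2, Query 8 12, RSub 8 8 7, RAdd 9 6 8, RDiv 9 6 9] ;;
    IfR 8 2 (Block [RConst 9 1]) (Block []) ;; toss ;; ?accept"
  let ?load = "Block [NAdd 8 11 2, RLoad 5 8, NAdd 9 12 2, RLoad 6 9]"
  have process: "hoare (\<lambda>R N v. M1 i R N v \<and> \<not> R 6 \<le> R 5) ?process (M2 i)" for i
  proof -
    \<comment> \<open>Fixing \<open>u\<close> and \<open>X\<close> makes the promises
      \<open>vr\<close> and \<open>va\<close> constants, as \<open>hoare_toss\<close>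
      demands.\<close>
    define W where "W u X = (\<lambda>R N v. M1 i R N v \<and> \<not> R 6 \<le> R 5 \<and> N 2 = u \<and> sel R (bs 1) = X)" for u X
    have "hoare (W u X) ?process (M2 i)" for u X
    proof -
      define vr va where "vr = V (Suc u) X" and "va = V (Suc u) (insert u X)"
      have eval: "hoare (W u X) ?eval (\<lambda>R N v. P i u X R N \<and> v \<le> vr + bias (n + k) (R 9) * (va - vr))"
      proof (rule hoare_wp)
        fix R N v
        assume W: "W u X R N v"
        then have fr: "frame z \<tau> g l j R N" and ce: "cells l j u R" and i: "n - u = Suc i"
          and N: "N 2 = u" "N 8 = bs 1 + u" "N 9 = bs 2 + u"
          and X: "sel R (bs 1) = X" "X \<subseteq> A l" and Y: "sel R (bs 2) = upper l u X" and v: "v \<le> V u X"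
          and R: "R 5 = R (bs 1 + u)" "R 6 = R (bs 2 + u)" "\<not> R 6 \<le> R 5"
          by (auto simp: W_def M1_def G_def)
        have u: "u < n" "0 < n"
          using i by auto
        \<comment> \<open>Both cells are still as \<open>start\<close> left them, so their
          comparison excludes the labels 0 and \<open>j\<close>.\<close>
        have "real (l u) > (if l u = j then real j else 0)"
          using ce R u unfolding cells_def by auto
        then have lu: "l u \<noteq> 0" "l u \<noteq> j"
          by (auto split: if_splits)
        have uA: "u \<in> A l"
          using lu u by (simp add: A_def)
        have "R (bs 1 + u) = 0"
          using ce u lu by (auto simp: cells_def)
        then have uX: "u \<notin> X"
          using X by (auto simp: sel_def)
        have u_upper: "u \<notin> upper l (Suc u) X" and upper_u: "upper l u X = insert u (upper l (Suc u) X)"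
          using uX uA by (auto simp: upper_def)
        have c: "N 11 = bs 1" "N 12 = bs 2" "R 1 = 1" "R 2 = 0" "N 5 = 1"
          using fr by (auto simp: frame_def env_def fixed_regs_def)
        define a b where "a = f (insert u X) - f X" and
          "b = f (upper l (Suc u) X) - f (insert u (upper l (Suc u) X))"
        have v': "v \<le> vr + bias (n + k) (if b \<le> 0 then 1 else a / (a + b)) * (va - vr)"
          using step[OF u(1) X(2) lu(1) uX refl a_def b_def] v unfolding vr_def va_def by linarith
        have ins: "insert u X - {u} = X" "X - {u} = X" "insert u (upper l (Suc u) X) - {u} = upper l (Suc u) X"
          using uX u_upper by auto
        have ce': "cells l j (Suc u) R"
          using ce by (auto simp: cells_def)
        show "wp ?eval (\<lambda>R N v. P i u X R N \<and> v \<le> vr + bias (n + k) (R 9) * (va - vr)) R N v"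
          using fr ce' i N X Y u c v' uA
          by (cases "b \<le> 0") (simp_all add: P_def frame_def env_def fixed_regs_def labels_def cells_def
              bs_eq_iff bs_inj upper_u ins flip: a_def b_def)
      qed
      have accept: "hoare (\<lambda>R N v. P i u X R N \<and> v \<le> (if 1 \<le> R 9 then va else vr)) ?accept (M2 i)"
      proof (rule hoare_wp, elim conjE)
        fix R N v
        assume Pux: "P i u X R N" and v: "v \<le> (if 1 \<le> R 9 then va else vr)"
        have u: "u < n" "0 < n"
          using Pux by (auto simp: P_def)
        have "upper l (Suc u) (insert u X) = insert u (upper l (Suc u) X)"
          by (auto simp: upper_def)
        then show "wp ?accept (M2 i) R N v"
          using Pux v u
          by (cases "1 \<le> R 9") (simp_all add: P_def M2_def G_def frame_def env_def fixed_regs_def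
              labels_def cells_def bs_eq_iff bs_inj vr_def va_def)
      qed
      have toss: "hoare (\<lambda>R N v. P i u X R N \<and> v \<le> vr + bias (n + k) (R 9) * (va - vr)) toss
          (\<lambda>R N v. P i u X R N \<and> v \<le> (if 1 \<le> R 9 then va else vr))"
        by (rule hoare_toss)
          (simp_all add: P_def frame_def env_def fixed_regs_def labels_def cells_def)
      have "hoare (W u X) (?eval ;; toss ;; ?accept) (M2 i)"
        by (rule hoare_Seq[OF eval hoare_Seq[OF toss accept]])
      then show ?thesis
        unfolding hoare_Seq_assoc .
    qed
    then have "hoare (\<lambda>R N v. \<exists>x. True \<and> W (fst x) (snd x) R N v) ?process (M2 i)"
      by (intro hoare_ghost)
    then show ?thesis
      by (rule hoare_conseq) (auto simp: W_def)
  qed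
  have "hoare (\<lambda>R N v. frame z \<tau> g l j R N \<and> cells l j 0 R \<and> v \<le> V 0 (D l j)) (Block [NConst 2 0]) I"
  proof (rule hoare_wp, elim conjE)
    fix R N v
    assume fr: "frame z \<tau> g l j R N" and ce: "cells l j 0 R" and v: "v \<le> V 0 (D l j)"
    have "1 \<le> j"
      using fr by (simp add: frame_def)
    then have "sel R (bs 1) = D l j" "sel R (bs 2) = A l" "D l j \<subseteq> A l"
      using ce by (auto simp: sel_def cells_def D_def A_def split: if_splits)
    moreover from this have "upper l 0 (D l j) = A l"
      by (auto simp: upper_def)
    ultimately show "wp (Block [NConst 2 0]) I R N v"
      using fr ce v by (simp add: I_def G_def frame_def env_def fixed_regs_def)
  qed
  moreover have "hoare I (While 2 0 (?load ;; IfR 6 5 (Block []) ?process ;; Block [NAdd 2 2 5]))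
      (\<lambda>R N v. I R N v \<and> N 0 \<le> N 2)"
  proof (rule hoare_While)
    fix i
    have "hoare (\<lambda>R N v. I R N v \<and> N 0 - N 2 = Suc i) ?load (M1 i)"
    proof (rule hoare_wp, elim conjE)
      fix R N v
      assume "I R N v" "N 0 - N 2 = Suc i"
      then show "wp ?load (M1 i) R N v"
        by (simp add: I_def M1_def G_def frame_def env_def fixed_regs_def labels_def cells_def)
    qed
    moreover have "hoare (M1 i) (IfR 6 5 (Block []) ?process) (M2 i)"
    proof (rule hoare_IfR[OF hoare_wp process], elim conjE)
      fix R N v
      assume M1: "M1 i R N v" and le: "R 6 \<le> R 5"
      define u X where "u = N 2" and "X = sel R (bs 1)"
      have u: "u < n"
        using M1 by (auto simp: M1_def u_def)
      have ce: "cells l j u R"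
        using M1 by (simp add: M1_def G_def u_def)
      then have "real (l u) \<le> (if l u = j then real j else 0)" "l u = j \<Longrightarrow> R (bs 1 + u) = real j"
        using M1 le u by (auto simp: M1_def cells_def u_def)
      moreover have "1 \<le> j"
        using M1 by (simp add: M1_def G_def frame_def)
      ultimately have lu: "l u = 0 \<or> u \<in> X"
        using u by (auto simp: X_def sel_def split: if_splits)
      have "x = u \<or> Suc u \<le> x" if "u \<le> x" for x
        using that by auto
      then have "upper l u X = upper l (Suc u) X"
        using lu by (fastforce simp: upper_def A_def)
      moreover have "V u X \<le> V (Suc u) X"
        using skip[OF u _ lu] M1 by (simp add: M1_def G_def X_def)
      moreover have "cells l j (Suc u) R"
        using ce by (auto simp: cells_def)
      ultimately show "wp (Block []) (M2 i) R N v"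
        using M1 by (simp add: M1_def M2_def G_def u_def X_def)
    qed
    moreover have "hoare (M2 i) (Block [NAdd 2 2 5]) (\<lambda>R N v. I R N v \<and> N 0 - N 2 \<le> i)"
    proof (rule hoare_wp)
      fix R N v
      assume M2: "M2 i R N v"
      then have "Suc (N 2) \<le> n" "n - Suc (N 2) \<le> i"
        unfolding M2_def by linarith+
      then show "wp (Block [NAdd 2 2 5]) (\<lambda>R N v. I R N v \<and> N 0 - N 2 \<le> i) R N v"
        using M2 by (simp add: I_def M2_def G_def frame_def env_def fixed_regs_def labels_def cells_def)
    qed
    ultimately show "hoare (\<lambda>R N v. I R N v \<and> N 0 - N 2 = Suc i)
        (?load ;; IfR 6 5 (Block []) ?process ;; Block [NAdd 2 2 5])
        (\<lambda>R N v. I R N v \<and> N 0 - N 2 \<le> i)"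
      by (intro hoare_Seq)
  next
    fix R N v
    assume "I R N v"
    then show "N 0 - N 2 \<le> 2 * n + k"
      by (simp add: I_def G_def frame_def env_def fixed_regs_def)
  qed
  ultimately have "hoare (\<lambda>R N v. frame z \<tau> g l j R N \<and> cells l j 0 R \<and> v \<le> V 0 (D l j)) double_greedy
      (\<lambda>R N v. I R N v \<and> N 0 \<le> N 2)"
    unfolding double_greedy_def by (rule hoare_Seq)
  then show ?thesis
  proof (rule hoare_conseq)
    fix R N v
    assume I: "I R N v \<and> N 0 \<le> N 2"
    then have "N 2 = n"
      by (simp add: I_def G_def frame_def env_def fixed_regs_def)
    then show "frame z \<tau> g l j R N \<and> sel R (bs 1) \<subseteq> A l \<and> v \<le> V n (sel R (bs 1))"
      using I by (simp add: I_def G_def)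
  qed
qed

lemma hoare_update:
  assumes X: "X \<subseteq> A l" "card (A l) \<le> 6 * k * B"
  shows "hoare (\<lambda>R N v. frame z \<tau> g l j R N \<and> sel R (bs 1) = X \<and> v = w) update
    (\<lambda>R N v. \<exists>z'. z \<le> z' \<and> f X \<le> z' \<and> frame z' \<tau> g l j R N \<and> v = w)"
proof -
  have card_X: "card X \<le> 6 * k * B"
    using card_mono[OF _ X(1)] X(2) by (simp add: A_def)
  define P where "P R N v \<longleftrightarrow> frame z \<tau> g l j R N \<and> sel R (bs 1) = X \<and> v = w \<and> R 5 = f X"
    for R N and v :: real
  \<comment> \<open>While copying, array 3 mixes the old and the new best set. Hence
    \<open>env\<close> cannot be kept, and its other parts are listed.\<close>
  define I where "I R N v \<longleftrightarrow> fixed_regs R N \<and> R 10 = f X \<and> z \<le> f X \<and> R 3 = \<tau> \<and> R 4 = \<sigma> \<and> N 4 = g \<and>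
    labels l R \<and> N 3 = j \<and> 1 \<le> j \<and> sel R (bs 1) = X \<and> v = w \<and> N 2 \<le> n \<and>
    (\<forall>x<N 2. R (bs 3 + x) = R (bs 1 + x))" for R N and v :: real
  define Q where "Q R N v \<longleftrightarrow> (\<exists>z'. z \<le> z' \<and> f X \<le> z' \<and> frame z' \<tau> g l j R N \<and> v = w)"
    for R N and v :: real
  let ?copy = "Block [NAdd 8 11 2, RLoad 0 8, NAdd 8 13 2, RStore 8 0, NAdd 2 2 5]"
  have "hoare (\<lambda>R N v. frame z \<tau> g l j R N \<and> sel R (bs 1) = X \<and> v = w) (Block [Query 5 11]) P"
    by (rule hoare_wp) (simp add: P_def frame_def env_def fixed_regs_def labels_def)
  moreover have "hoare P (IfR 5 10 (Block []) (Block [RAdd 10 5 2, NConst 2 0] ;; While 2 0 ?copy)) Q"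
  proof (rule hoare_IfR[OF hoare_wp hoare_Seq])
    show "wp (Block []) Q R N v" if "P R N v \<and> R 5 \<le> R 10" for R N v
      using that by (auto simp: P_def Q_def frame_def env_def)
    show "hoare (\<lambda>R N v. P R N v \<and> \<not> R 5 \<le> R 10) (Block [RAdd 10 5 2, NConst 2 0]) I"
      by (rule hoare_wp) (simp add: P_def I_def frame_def env_def fixed_regs_def labels_def)
    have "hoare I (While 2 0 ?copy) (\<lambda>R N v. I R N v \<and> N 0 \<le> N 2)"
    proof (rule hoare_While)
      fix i
      show "hoare (\<lambda>R N v. I R N v \<and> N 0 - N 2 = Suc i) ?copy (\<lambda>R N v. I R N v \<and> N 0 - N 2 \<le> i)"
      proof (rule hoare_wp, elim conjE)
        fix R N v
        assume I: "I R N v" and i: "N 0 - N 2 = Suc i"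
        have "N 2 < n" "0 < n"
          using I i by (auto simp: I_def fixed_regs_def)
        then show "wp ?copy (\<lambda>R N v. I R N v \<and> N 0 - N 2 \<le> i) R N v"
          using I i by (simp add: I_def fixed_regs_def labels_def bs_eq_iff bs_inj less_Suc_eq)
      qed
    next
      fix R N v
      assume "I R N v"
      then show "N 0 - N 2 \<le> 2 * n + k"
        by (simp add: I_def fixed_regs_def)
    qed
    then show "hoare I (While 2 0 ?copy) Q"
    proof (rule hoare_conseq)
      fix R N v
      assume I: "I R N v \<and> N 0 \<le> N 2"
      then have "N 2 = n"
        by (simp add: I_def fixed_regs_def)
      then have "sel R (bs 3) = X"
        using I by (auto simp: I_def sel_def)
      then have "frame (f X) \<tau> g l j R N"
        using I card_X by (simp add: I_def frame_def env_def)
      then show "Q R N v"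
        using I by (auto simp: I_def Q_def)
    qed
  qed
  ultimately show ?thesis
    unfolding update_def Q_def by (rule hoare_Seq)
qed

section \<open>The potential of double greedy\<close>

lemma F_nonneg: "0 \<le> F"
  using nonneg[OF opt(1)] opt(3) by simp

text \<open>The argument of the first \<open>f\<close> is the moving target: it agrees with
  \<open>X\<close> on decided elements and contains the undecided part of \<open>S\<close>. The last
  term reserves the coin error of the decisions still to come.\<close>

definition value_of :: "(nat \<Rightarrow> nat) \<Rightarrow> nat set \<Rightarrow> nat \<Rightarrow> nat set \<Rightarrow> real" where
  "value_of l S u X = f (X \<union> {x \<in> S. u \<le> x}) / 2 + f X / 4 + f (upper l u X) / 4 -
     real (n - u) * (F / 2 ^ (n + k))"

text \<open>This is why \<open>n + k\<close> fair coins suffice: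
  \<open>n * k \<le> 2 ^ n * 2 ^ k\<close>, so all \<open>n\<close> errors together cost at most
  \<open>F / k\<close>. The share of the upper set \<open>A l\<close> is dropped.\<close>

lemma value_of_0:
  assumes "D l j \<subseteq> S" "S \<subseteq> A l" "1 \<le> j"
  shows "f S / 2 + f (D l j) / 4 - F / k \<le> value_of l S 0 (D l j)"
proof -
  have sets: "D l j \<union> {x \<in> S. 0 \<le> x} = S" "upper l 0 (D l j) = A l"
    using assms by (auto simp: upper_def D_def A_def)
  have "real n * (F / 2 ^ (n + k)) \<le> F / k"
  proof -
    have "n * k \<le> 2 ^ n * 2 ^ k"
      by (intro mult_mono) (auto intro: less_imp_le)
    then have "real n * real k \<le> 2 ^ n * 2 ^ k"
      by (metis (mono_tags) of_nat_le_iff of_nat_mult of_nat_numeral of_nat_power)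
    then have "F * (real n * real k) \<le> F * 2 ^ (n + k)"
      using F_nonneg unfolding power_add by (rule mult_left_mono)
    then show ?thesis
      using k by (simp add: field_simps)
  qed
  moreover have "0 \<le> f (A l)"
    using A_subset by (rule nonneg)
  ultimately show ?thesis
    unfolding value_of_def sets by simp
qed

lemma value_of_n: "X \<subseteq> A l \<Longrightarrow> S \<subseteq> A l \<Longrightarrow> value_of l S n X = f X"
proof -
  assume "X \<subseteq> A l" "S \<subseteq> A l"
  then have "X \<union> {x \<in> S. n \<le> x} = X" "upper l n X = X"
    by (auto simp: upper_def A_def)
  then show ?thesis
    by (simp add: value_of_def)
qed

lemma value_of_skip:
  assumes "u < n" "l u = 0 \<or> u \<in> X" "S \<subseteq> A l"
  shows "value_of l S u X \<le> value_of l S (Suc u) X"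
proof -
  have "u \<le> x \<longleftrightarrow> x = u \<or> Suc u \<le> x" for x
    by auto
  then have "X \<union> {x \<in> S. u \<le> x} = X \<union> {x \<in> S. Suc u \<le> x}" "upper l u X = upper l (Suc u) X"
    using assms by (auto simp: upper_def A_def)
  moreover have "real (n - Suc u) * (F / 2 ^ (n + k)) \<le> real (n - u) * (F / 2 ^ (n + k))"
    using F_nonneg by (intro mult_right_mono) auto
  ultimately show ?thesis
    by (simp add: value_of_def)
qed

text \<open>Applies \<open>double_greedy_step\<close> to the target \<open>S1\<close> without
  \<open>u\<close>. The coin error of this decision comes out of the reserve, and it is measured by
  \<open>F\<close> because no gain exceeds the value of a singleton.\<close>

lemma value_of_step:
  assumes u: "u < n" "l u \<noteq> 0" "u \<notin> X" and X: "X \<subseteq> A l" and S: "S \<subseteq> A l"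
    and card_A: "card (A l) \<le> 6 * k * B" and Y: "Y = upper l (Suc u) X"
    and a: "a = f (insert u X) - f X" and b: "b = f Y - f (insert u Y)"
  shows "value_of l S u X \<le> value_of l S (Suc u) X +
    bias (n + k) (if b \<le> 0 then 1 else a / (a + b)) *
      (value_of l S (Suc u) (insert u X) - value_of l S (Suc u) X)"
proof -
  define S1 where "S1 = X \<union> {x \<in> S. Suc u \<le> x}"
  define \<eta> where "\<eta> = F / 2 ^ (n + k)"
  define vr where "vr = f S1 / 2 + f X / 4 + f Y / 4"
  define va where "va = f (insert u S1) / 2 + f (insert u X) / 4 + f (insert u Y) / 4"
  have uA: "u \<in> A l"
    using u by (simp add: A_def)
  \<comment> \<open>A nonempty \<open>A l\<close> within the size limit forces \<open>B\<close> to
    be positive, so singletons are feasible.\<close>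
  have "card (A l) \<noteq> 0"
    using uA by (auto simp: A_def card_eq_0_iff)
  then have B: "1 \<le> B"
    using card_A by (cases B) auto
  have "a \<le> f {u} - f {}"
    using submodular_on_insert[OF sm, of "{}" X u] X A_subset u unfolding a by auto
  then have aF: "a \<le> F"
    using singleton_le[OF u(1) B] nonneg[of "{}"] by simp
  have le: "u \<le> x \<longleftrightarrow> x = u \<or> Suc u \<le> x" for x
    by auto
  have eq: "X \<union> {x \<in> S. u \<le> x} = S1 \<or> X \<union> {x \<in> S. u \<le> x} = insert u S1"
    unfolding S1_def le by auto
  have "f (X \<union> {x \<in> S. u \<le> x}) / 2 + f X / 4 + f (insert u Y) / 4 - F / 2 ^ (n + k) \<le>
      vr + bias (n + k) (if b \<le> 0 then 1 else a / (a + b)) * (va - vr)"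
  proof (rule double_greedy_step[OF sm _ _ _ _ _ a b refl aF F_nonneg eq vr_def va_def])
    show "u \<in> {..<n}" "u \<notin> Y" "X \<subseteq> S1" "S1 \<subseteq> Y" "Y \<subseteq> {..<n}"
      using u X S A_subset[of l] by (auto simp: Y upper_def S1_def)
  qed
  moreover have "value_of l S u X = f (X \<union> {x \<in> S. u \<le> x}) / 2 + f X / 4 + f (insert u Y) / 4 -
      (real (n - Suc u) + 1) * \<eta>"
  proof -
    have "upper l u X = insert u Y"
      using uA unfolding Y upper_def le by auto
    moreover have "real (n - u) = real (n - Suc u) + 1"
      using u by linarith
    ultimately show ?thesis
      by (simp only: value_of_def \<eta>_def)
  qed
  moreover have "value_of l S (Suc u) X = vr - real (n - Suc u) * \<eta>"
    by (simp only: value_of_def vr_def \<eta>_def S1_def Y)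
  moreover have "value_of l S (Suc u) (insert u X) = va - real (n - Suc u) * \<eta>"
  proof -
    have "upper l (Suc u) (insert u X) = insert u Y"
      "insert u X \<union> {x \<in> S. Suc u \<le> x} = insert u S1"
      by (auto simp: Y upper_def S1_def)
    then show ?thesis
      by (simp only: value_of_def va_def \<eta>_def)
  qed
  ultimately show ?thesis
    by (simp only: \<eta>_def[symmetric] distrib_right) simp
qed

section \<open>Guesses and promises\<close>

definition hit :: "real \<Rightarrow> bool" where
  "hit \<tau> \<longleftrightarrow> 1 \<le> B \<and> 0 < F \<and> F / 2 \<le> \<tau> * (real k * real B) \<and> \<tau> * (real k * real B) \<le> F"

definition pending :: "nat \<Rightarrow> real \<Rightarrow> bool" where
  "pending g v \<longleftrightarrow> v \<le> F / 2 - 2 * F / k \<and> (\<exists>i. g < i \<and> i \<le> 2 * n \<and> hit (real i * \<sigma>))"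

text \<open>The reasons why the promise \<open>v\<close> can still be kept after candidates
  \<open>1..j\<close> of guess \<open>g\<close>: the best set found suffices, a later guess is
  right, or a later candidate of this guess is a good start.\<close>

definition alive :: "nat \<Rightarrow> (nat \<Rightarrow> nat) \<Rightarrow> nat \<Rightarrow> real \<Rightarrow> real \<Rightarrow> bool" where
  "alive g l j z v \<longleftrightarrow> v \<le> z \<or> pending g v \<or>
     (\<exists>i>j. i \<le> k \<and> (\<exists>S. D l i \<subseteq> S \<and> S \<subseteq> A l \<and> v \<le> f S / 2 + f (D l i) / 4 - F / k))"

lemma alive_mono:
  assumes "alive g l j z w" "v \<le> w" "z \<le> z'"
  shows "alive g l j z' v"
proof -
  have "v \<le> y" if "w \<le> y" for y
    using that assms(2) by simp
  moreover have "w \<le> z'" if "w \<le> z"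
    using that assms(3) by simp
  ultimately show ?thesis
    using assms(1) unfolding alive_def pending_def by blast
qed

text \<open>Either the promise survives without candidate \<open>Suc j\<close>, which then runs with
  a constant potential, or this candidate is the good one. In that case \<open>value_of l S\<close>
  turns the promise into a bound on the value of the set it returns.\<close>

lemma hoare_candidate:
  assumes card_A: "card (A l) \<le> 6 * k * B" and w: "alive g l j z w"
  shows "hoare (\<lambda>R N v. frame z \<tau> g l (Suc j) R N \<and> v = w) (start ;; double_greedy ;; update)
    (\<lambda>R N v. \<exists>z'. frame z' \<tau> g l (Suc j) R N \<and> alive g l (Suc j) z' v)"
proof -
  have *: ?thesis
    if skip: "\<And>u X. u < n \<Longrightarrow> X \<subseteq> A l \<Longrightarrow> l u = 0 \<or> u \<in> X \<Longrightarrow> V u X \<le> V (Suc u) X"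
      and step: "\<And>u X Y a b. u < n \<Longrightarrow> X \<subseteq> A l \<Longrightarrow> l u \<noteq> 0 \<Longrightarrow> u \<notin> X \<Longrightarrow> Y = upper l (Suc u) X \<Longrightarrow>
        a = f (insert u X) - f X \<Longrightarrow> b = f Y - f (insert u Y) \<Longrightarrow>
        V u X \<le> V (Suc u) X + bias (n + k) (if b \<le> 0 then 1 else a / (a + b)) *
          (V (Suc u) (insert u X) - V (Suc u) X)"
      and init: "w \<le> V 0 (D l (Suc j))"
      and final: "\<And>X z' v. X \<subseteq> A l \<Longrightarrow> v \<le> V n X \<Longrightarrow> z \<le> z' \<Longrightarrow> f X \<le> z' \<Longrightarrow>
        alive g l (Suc j) z' v" for V :: "nat \<Rightarrow> nat set \<Rightarrow> real"
  proof -
    have s: "hoare (\<lambda>R N v. frame z \<tau> g l (Suc j) R N \<and> v = w) start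
        (\<lambda>R N v. frame z \<tau> g l (Suc j) R N \<and> cells l (Suc j) 0 R \<and> v \<le> V 0 (D l (Suc j)))"
      by (rule hoare_conseq[OF hoare_start]) (use init in auto)
    have u: "hoare (\<lambda>R N v. frame z \<tau> g l (Suc j) R N \<and> sel R (bs 1) \<subseteq> A l \<and> v \<le> V n (sel R (bs 1)))
        update (\<lambda>R N v. \<exists>z'. frame z' \<tau> g l (Suc j) R N \<and> alive g l (Suc j) z' v)"
    proof (rule hoare_conseq)
      show "hoare (\<lambda>R N v. \<exists>x. (fst x \<subseteq> A l \<and> snd x \<le> V n (fst x)) \<and>
            (frame z \<tau> g l (Suc j) R N \<and> sel R (bs 1) = fst x \<and> v = snd x))
          update (\<lambda>R N v. \<exists>z'. frame z' \<tau> g l (Suc j) R N \<and> alive g l (Suc j) z' v)"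
      proof (rule hoare_ghost)
        fix x :: "nat set \<times> real"
        assume x: "fst x \<subseteq> A l \<and> snd x \<le> V n (fst x)"
        show "hoare (\<lambda>R N v. frame z \<tau> g l (Suc j) R N \<and> sel R (bs 1) = fst x \<and> v = snd x)
          update (\<lambda>R N v. \<exists>z'. frame z' \<tau> g l (Suc j) R N \<and> alive g l (Suc j) z' v)"
        proof (rule hoare_conseq)
          show "hoare (\<lambda>R N v. frame z \<tau> g l (Suc j) R N \<and> sel R (bs 1) = fst x \<and> v = snd x) update
            (\<lambda>R N v. \<exists>z'. z \<le> z' \<and> f (fst x) \<le> z' \<and> frame z' \<tau> g l (Suc j) R N \<and> v = snd x)"
            using x by (intro hoare_update card_A) simp
        next
          fix R N v
          assume "\<exists>z'. z \<le> z' \<and> f (fst x) \<le> z' \<and> frame z' \<tau> g l (Suc j) R N \<and> v = snd x"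
          then obtain z' where "z \<le> z'" "f (fst x) \<le> z'" "frame z' \<tau> g l (Suc j) R N" "v = snd x"
            by blast
          moreover from this have "alive g l (Suc j) z' v"
            using x by (intro final[of "fst x"]) auto
          ultimately show "\<exists>z'. frame z' \<tau> g l (Suc j) R N \<and> alive g l (Suc j) z' v"
            by blast
        qed simp
      qed
    qed auto
    show ?thesis
      by (rule hoare_Seq[OF s hoare_Seq[OF hoare_double_greedy[OF skip step] u]])
  qed
  show ?thesis
  proof (cases "alive g l (Suc j) z w")
    case True
    show ?thesis
    proof (rule *[of "\<lambda>_ _. w"])
      show "alive g l (Suc j) z' v" if "v \<le> w" "z \<le> z'" for z' v
        using alive_mono[OF True that] .
    qed auto
  next
    case False
    then obtain i S where i: "j < i" "i \<le> k" "\<not> Suc j < i"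
      and S: "D l i \<subseteq> S" "S \<subseteq> A l" "w \<le> f S / 2 + f (D l i) / 4 - F / k"
      using w unfolding alive_def by blast
    have "i = Suc j"
      using i by simp
    note S = S[unfolded this]
    show ?thesis
    proof (rule *[of "value_of l S"])
      show "w \<le> value_of l S 0 (D l (Suc j))"
        using value_of_0[OF S(1,2)] S(3) by simp
      show "alive g l (Suc j) z' v" if "X \<subseteq> A l" "v \<le> value_of l S n X" "f X \<le> z'" for X z' v
        using that value_of_n[OF that(1) S(2)] by (auto simp: alive_def)
      show "value_of l S u X \<le> value_of l S (Suc u) X" if "u < n" "l u = 0 \<or> u \<in> X" for u X
        using value_of_skip[OF that S(2)] .
      show "value_of l S u X \<le> value_of l S (Suc u) X +
          bias (n + k) (if b \<le> 0 then 1 else a / (a + b)) *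
            (value_of l S (Suc u) (insert u X) - value_of l S (Suc u) X)"
        if "u < n" "X \<subseteq> A l" "l u \<noteq> 0" "u \<notin> X" "Y = upper l (Suc u) X"
          "a = f (insert u X) - f X" "b = f Y - f (insert u Y)" for u X Y a b
        using value_of_step[OF that(1,3,4,2) S(2) card_A that(5,6,7)] .
    qed
  qed
qed

text \<open>One \<open>F / k\<close> is the loss of the good starting set, the other one pays for
  the simulated coins.\<close>

lemma built_alive:
  assumes "built \<tau> k l" "hit \<tau>" "v \<le> F / 2 - 2 * F / k"
  shows "alive g l 0 z v"
proof -
  have snd: "sound \<tau> k l"
    using assms(1) by (simp add: built_def)
  have A: "A l = (\<Union>j\<in>{1..k}. D l j)"
    using snd by (auto simp: sound_def A_def D_def)
  have disj: "disjoint_family_on (D l) {1..k}"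
    by (auto simp: disjoint_family_on_def D_def)
  have "\<exists>J\<le>k. (\<forall>j\<in>{1..J}. \<forall>x<n. small \<tau> l j x) \<and>
      (J = k \<or> (J < k \<and> card (A l) = 6 * k * B \<and> (\<forall>j\<in>{1..k}. j > Suc J \<longrightarrow> D l j = {})))"
    using assms(1) unfolding built_def
  proof (elim conjE disjE)
    assume "full \<tau> k l"
    then obtain J where J: "card (A l) = 6 * k * B" "J < k" "\<forall>i\<in>{1..J}. \<forall>x<n. small \<tau> l i x"
      "\<forall>x<n. l x \<le> Suc J"
      unfolding full_def by blast
    have "D l j = {}" if "j > Suc J" for j
      using J(4) that by (auto simp: D_def)
    then show ?thesis
      using J(1-3) less_imp_le[OF J(2)] by blast
  qed blast
  then obtain J where J: "J \<le> k" "\<forall>j\<in>{1..J}. \<forall>x<n. small \<tau> l j x"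
    "J = k \<or> (J < k \<and> card (A l) = 6 * k * B \<and> (\<forall>j\<in>{1..k}. j > Suc J \<longrightarrow> D l j = {}))"
    by blast
  have h: "F / 2 \<le> \<tau> * (real k * real B)" "\<tau> * (real k * real B) \<le> F" "0 < F" "1 \<le> B"
    using assms(2) by (auto simp: hit_def)
  have "\<exists>j\<in>{1..k}. \<exists>S. D l j \<subseteq> S \<and> S \<subseteq> A l \<and> F / 2 - F / k \<le> f S / 2 + f (D l j) / 4"
  proof (rule exists_good_start_cases[OF sm nn _ D_subset disj A opt h k _ _ J(1) _ J(3)])
    show "\<tau> = \<tau> * (real k * real B) / (real k * real B)"
      using h(4) k by simp
    show "\<tau> * real (card (D l j)) \<le> f (D l j)" if "j \<in> {1..k}" for j
      using snd that by (simp add: sound_def)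
    show "f (insert x (D l j)) - f (D l j) \<le> \<tau>" if "j \<in> {1..J}" "x \<in> {..<n} - A l" for j x
      using J(2) that by (auto simp: small_def A_def)
  qed simp
  then obtain j S where j: "j \<in> {1..k}" "D l j \<subseteq> S" "S \<subseteq> A l" "F / 2 - F / k \<le> f S / 2 + f (D l j) / 4"
    by blast
  moreover have "v \<le> f S / 2 + f (D l j) / 4 - F / k"
    using assms(3) j(4) by simp
  moreover have "0 < j" "j \<le> k"
    using j(1) by auto
  ultimately show ?thesis
    unfolding alive_def by blast
qed

definition main_inv :: assn where
  "main_inv R N v \<longleftrightarrow> (\<exists>z g. g \<le> 2 * n \<and> (v \<le> z \<or> pending g v) \<and> env z (real g * \<sigma>) g R N)"

lemma hoare_candidates:
  assumes l: "card (A l) \<le> 6 * k * B" "alive g l 0 z w"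
  shows "hoare (\<lambda>R N v. env z \<tau> g R N \<and> labels l R \<and> v = w)
    (Block [NConst 3 0] ;; While 3 14 (Block [NAdd 3 3 5] ;; start ;; double_greedy ;; update))
    (\<lambda>R N v. \<exists>z. env z \<tau> g R N \<and> (v \<le> z \<or> pending g v))"
proof -
  define I where "I R N v \<longleftrightarrow> (\<exists>z. env z \<tau> g R N \<and> labels l R \<and> N 3 \<le> k \<and> alive g l (N 3) z v)"
    for R N v
  let ?body = "Block [NAdd 3 3 5] ;; start ;; double_greedy ;; update"
  have "hoare (\<lambda>R N v. env z \<tau> g R N \<and> labels l R \<and> v = w) (Block [NConst 3 0]) I"
    by (rule hoare_wp) (use l(2) in \<open>auto simp: I_def env_def fixed_regs_def\<close>)
  moreover have "hoare I (While 3 14 ?body) (\<lambda>R N v. \<exists>z. env z \<tau> g R N \<and> (v \<le> z \<or> pending g v))"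
  proof (rule hoare_conseq[OF hoare_While])
    fix i
    have "hoare (\<lambda>R N v. \<exists>x. (k - snd x = Suc i \<and> alive g l (snd x) (fst (fst x)) (snd (fst x))) \<and>
          (env (fst (fst x)) \<tau> g R N \<and> labels l R \<and> N 3 = snd x \<and> v = snd (fst x)))
        ?body (\<lambda>R N v. I R N v \<and> N 14 - N 3 \<le> i)"
    proof (rule hoare_ghost)
      fix x :: "(real \<times> real) \<times> nat"
      assume x: "k - snd x = Suc i \<and> alive g l (snd x) (fst (fst x)) (snd (fst x))"
      obtain z w j where zwj: "x = ((z, w), j)"
        by (cases x) auto
      have j: "k - j = Suc i" "alive g l j z w" "Suc j \<le> k" "k - Suc j \<le> i"
        using x by (auto simp: zwj)
      have "hoare (\<lambda>R N v. env z \<tau> g R N \<and> labels l R \<and> N 3 = j \<and> v = w) (Block [NAdd 3 3 5])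
          (\<lambda>R N v. frame z \<tau> g l (Suc j) R N \<and> v = w)"
        by (rule hoare_wp) (simp add: frame_def env_def fixed_regs_def)
      moreover have "hoare (\<lambda>R N v. frame z \<tau> g l (Suc j) R N \<and> v = w) (start ;; double_greedy ;; update)
          (\<lambda>R N v. I R N v \<and> N 14 - N 3 \<le> i)"
      proof (rule hoare_conseq[OF hoare_candidate[OF l(1) j(2)]])
        fix R N v
        assume "\<exists>z'. frame z' \<tau> g l (Suc j) R N \<and> alive g l (Suc j) z' v"
        then obtain z' where "frame z' \<tau> g l (Suc j) R N" "alive g l (Suc j) z' v"
          by blast
        moreover from this have "N 14 = k" "N 3 = Suc j"
          by (auto simp: frame_def env_def fixed_regs_def)
        ultimately show "I R N v \<and> N 14 - N 3 \<le> i"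
          using j(3,4) by (auto simp: I_def frame_def)
      qed auto
      ultimately have "hoare (\<lambda>R N v. env z \<tau> g R N \<and> labels l R \<and> N 3 = j \<and> v = w) ?body
          (\<lambda>R N v. I R N v \<and> N 14 - N 3 \<le> i)"
        by (rule hoare_Seq)
      then show "hoare (\<lambda>R N v. env (fst (fst x)) \<tau> g R N \<and> labels l R \<and> N 3 = snd x \<and> v = snd (fst x))
          ?body (\<lambda>R N v. I R N v \<and> N 14 - N 3 \<le> i)"
        by (simp add: zwj)
    qed
    then show "hoare (\<lambda>R N v. I R N v \<and> N 14 - N 3 = Suc i) ?body (\<lambda>R N v. I R N v \<and> N 14 - N 3 \<le> i)"
    proof (rule hoare_conseq)
      fix R N v
      assume I: "I R N v \<and> N 14 - N 3 = Suc i"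
      then obtain z where "env z \<tau> g R N" "labels l R" "alive g l (N 3) z v"
        by (auto simp: I_def)
      moreover from this I have "k - N 3 = Suc i"
        by (simp add: env_def fixed_regs_def)
      ultimately show "\<exists>x. (k - snd x = Suc i \<and> alive g l (snd x) (fst (fst x)) (snd (fst x))) \<and>
          (env (fst (fst x)) \<tau> g R N \<and> labels l R \<and> N 3 = snd x \<and> v = snd (fst x))"
        by (intro exI[of _ "((z, v), N 3)"]) simp
    qed
  next
    fix R N v
    assume "I R N v"
    then show "N 14 - N 3 \<le> 2 * n + k"
      by (auto simp: I_def env_def fixed_regs_def)
  next
    fix R N v
    assume I: "I R N v \<and> N 14 \<le> N 3"
    then obtain z where z: "env z \<tau> g R N" "N 3 \<le> k" "alive g l (N 3) z v"
      by (auto simp: I_def)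
    then have "N 3 = k"
      using I by (simp add: env_def fixed_regs_def)
    then have "v \<le> z \<or> pending g v"
      using z(3) by (auto simp: alive_def)
    then show "\<exists>z. env z \<tau> g R N \<and> (v \<le> z \<or> pending g v)"
      using z(1) by blast
  qed
  ultimately show ?thesis
    by (rule hoare_Seq)
qed

lemma hoare_guess_round:
  "hoare (\<lambda>R N v. main_inv R N v \<and> N 15 - N 4 = Suc i) guess_round
    (\<lambda>R N v. main_inv R N v \<and> N 15 - N 4 \<le> i)"
proof -
  have "hoare (\<lambda>R N v. \<exists>x. (2 * n - snd x = Suc i \<and>
        (snd (fst x) \<le> fst (fst x) \<or> pending (snd x) (snd (fst x)))) \<and>
        (env (fst (fst x)) (real (snd x) * \<sigma>) (snd x) R N \<and> v = snd (fst x)))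
      guess_round (\<lambda>R N v. main_inv R N v \<and> N 15 - N 4 \<le> i)"
  proof (rule hoare_ghost)
    fix x :: "(real \<times> real) \<times> nat"
    assume x: "2 * n - snd x = Suc i \<and>
        (snd (fst x) \<le> fst (fst x) \<or> pending (snd x) (snd (fst x)))"
    obtain z w g where zwg: "x = ((z, w), g)"
      by (cases x) auto
    have g: "2 * n - g = Suc i" "w \<le> z \<or> pending g w" "Suc g \<le> 2 * n" "2 * n - Suc g \<le> i"
      using x by (auto simp: zwg)
    define \<tau> where "\<tau> = real (Suc g) * \<sigma>"
    have alive: "alive (Suc g) l 0 z w" if "built \<tau> k l" for l
    proof (cases "w \<le> z \<or> pending (Suc g) w")
      case True
      then show ?thesis
        by (auto simp: alive_def)
    next
      case False
      then obtain i where i: "w \<le> F / 2 - 2 * F / k" "g < i" "\<not> Suc g < i" "hit (real i * \<sigma>)"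
        using g(2) unfolding pending_def by blast
      then have "i = Suc g"
        by simp
      then have "hit \<tau>"
        using i(4) by (simp only: \<tau>_def)
      then show ?thesis
        using built_alive[OF that _ i(1)] by simp
    qed
    have advance: "hoare (\<lambda>R N v. env z (real g * \<sigma>) g R N \<and> v = w) (Block [RAdd 3 3 4, NAdd 4 4 5])
        (\<lambda>R N v. env z \<tau> (Suc g) R N \<and> v = w)"
      by (rule hoare_wp) (simp add: env_def fixed_regs_def \<tau>_def algebra_simps)
    have build: "hoare (\<lambda>R N v. env z \<tau> (Suc g) R N \<and> v = w) build
        (\<lambda>R N v. \<exists>l. built \<tau> k l \<and> (env z \<tau> (Suc g) R N \<and> labels l R \<and> v = w))"
      by (rule hoare_conseq[OF hoare_build]) auto
    have candidates: "hoare (\<lambda>R N v. \<exists>l. built \<tau> k l \<and> (env z \<tau> (Suc g) R N \<and> labels l R \<and> v = w))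
        (Block [NConst 3 0] ;; While 3 14 (Block [NAdd 3 3 5] ;; start ;; double_greedy ;; update))
        (\<lambda>R N v. main_inv R N v \<and> N 15 - N 4 \<le> i)"
    proof (rule hoare_ghost)
      fix l
      assume built: "built \<tau> k l"
      have card: "card (A l) \<le> 6 * k * B"
        using built by (simp add: built_def sound_def)
      show "hoare (\<lambda>R N v. env z \<tau> (Suc g) R N \<and> labels l R \<and> v = w)
        (Block [NConst 3 0] ;; While 3 14 (Block [NAdd 3 3 5] ;; start ;; double_greedy ;; update))
        (\<lambda>R N v. main_inv R N v \<and> N 15 - N 4 \<le> i)"
      proof (rule hoare_conseq[OF hoare_candidates[OF card alive[OF built]]])
        fix R N v
        assume "\<exists>z. env z \<tau> (Suc g) R N \<and> (v \<le> z \<or> pending (Suc g) v)"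
        then obtain z where z: "env z \<tau> (Suc g) R N" "v \<le> z \<or> pending (Suc g) v"
          by blast
        have "main_inv R N v"
          unfolding main_inv_def using z g(3) unfolding \<tau>_def by blast
        moreover have "N 15 = 2 * n" "N 4 = Suc g"
          using z(1) by (auto simp: env_def fixed_regs_def)
        ultimately show "main_inv R N v \<and> N 15 - N 4 \<le> i"
          using g(4) by simp
      qed auto
    qed
    have "hoare (\<lambda>R N v. env z (real g * \<sigma>) g R N \<and> v = w) guess_round
        (\<lambda>R N v. main_inv R N v \<and> N 15 - N 4 \<le> i)"
      unfolding guess_round_def by (rule hoare_Seq[OF advance hoare_Seq[OF build candidates]])
    then show "hoare (\<lambda>R N v. env (fst (fst x)) (real (snd x) * \<sigma>) (snd x) R N \<and> v = snd (fst x))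
        guess_round (\<lambda>R N v. main_inv R N v \<and> N 15 - N 4 \<le> i)"
      by (simp add: zwg)
  qed
  then show ?thesis
  proof (rule hoare_conseq)
    fix R N v
    assume I: "main_inv R N v \<and> N 15 - N 4 = Suc i"
    then obtain z g where "v \<le> z \<or> pending g v" "env z (real g * \<sigma>) g R N"
      by (auto simp: main_inv_def)
    moreover from this I have "2 * n - g = Suc i"
      by (simp add: env_def fixed_regs_def)
    ultimately show "\<exists>x. (2 * n - snd x = Suc i \<and>
        (snd (fst x) \<le> fst (fst x) \<or> pending (snd x) (snd (fst x)))) \<and>
        (env (fst (fst x)) (real (snd x) * \<sigma>) (snd x) R N \<and> v = snd (fst x))"
      by (intro exI[of _ "((z, v), g)"]) simp
  qed
qed

text \<open>If \<open>F = 0\<close> or \<open>opt\<close> is empty, the empty set suffices.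
  Otherwise the sum \<open>M\<close> of singleton values satisfies
  \<open>F \<le> M \<le> n * F\<close>, so the spacing \<open>M / (2 * n)\<close> is at most
  \<open>F / 2\<close> and its first \<open>2 * n\<close> multiples reach \<open>F\<close>.\<close>

lemma exists_guess: "F / 2 - 2 * F / k \<le> f {} \<or> pending 0 (F / 2 - 2 * F / k)"
proof (cases "F = 0 \<or> opt = {}")
  case True
  then have "F \<le> f {}"
    using opt(3) nonneg[of "{}"] by auto
  moreover have "0 \<le> 2 * F / k"
    using F_nonneg by simp
  ultimately have "F / 2 - 2 * F / k \<le> f {}"
    using F_nonneg by linarith
  then show ?thesis ..
next
  case False
  define M where "M = (\<Sum>x<n. f {x})"
  define q where "q = M / (2 * n)"
  have fin: "finite opt"
    using opt(1) by (rule finite_subset) simp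
  have F: "0 < F"
    using False F_nonneg by simp
  have B: "1 \<le> B"
    using opt(2) False fin by (metis One_nat_def Suc_le_eq card_gt_0_iff order_less_le_trans)
  have n: "1 \<le> n"
    using False opt(1) by (cases n) auto
  have "F \<le> (\<Sum>x\<in>opt. f {x})"
    using submodular_on_le_sum_singletons[OF sm nn fin opt(1)] False opt(3) by simp
  also have "\<dots> \<le> M"
    unfolding M_def using opt(1) by (intro sum_mono2) (auto intro: nonneg)
  finally have M: "F \<le> M" .
  have "M \<le> (\<Sum>x<n. F)"
    unfolding M_def using singleton_le B by (intro sum_mono) auto
  then have q: "q \<le> F / 2" "0 < q" "F \<le> 2 * n * q"
    using n M F by (auto simp: q_def field_simps)
  \<comment> \<open>The largest multiple of \<open>q\<close> not above \<open>F\<close>; it exceeds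
    \<open>F - q\<close>, which is at least \<open>F / 2\<close>.\<close>
  define i where "i = nat \<lfloor>F / q\<rfloor>"
  have "0 \<le> F / q"
    using F q by simp
  then have i: "real i \<le> F / q" "F / q < real i + 1"
    unfolding i_def by linarith+
  have iq: "real i * q \<le> F" "F < real i * q + q"
    using i q(2) by (simp_all add: field_simps)
  have "real i * q \<le> real (2 * n) * q"
    using iq(1) q(3) by (rule order.trans)
  then have "i \<le> 2 * n"
    using q(2) by (simp only: mult_le_cancel_right_pos of_nat_le_iff)
  moreover have "0 < i"
    using iq q F by (cases i) auto
  moreover have "\<sigma> * (real k * real B) = q"
    using k B by (simp add: \<sigma>_def q_def M_def)
  then have eq: "real i * \<sigma> * (real k * real B) = real i * q"
    by (simp only: mult.assoc)
  have "hit (real i * \<sigma>)"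
    unfolding hit_def eq using B F iq q(1) by simp
  ultimately have "pending 0 (F / 2 - 2 * F / k)"
    unfolding pending_def by blast
  then show ?thesis ..
qed

section \<open>Initialisation, main loop and output\<close>

definition summing :: "real \<Rightarrow> assn" where
  "summing w R N v \<longleftrightarrow> fixed_regs R N \<and> R 3 = 0 \<and> R 4 = (\<Sum>x<N 2. f {x}) \<and> N 2 \<le> n \<and>
     sel R (bs 1) = {} \<and> sel R (bs 3) = {} \<and> v = w"

lemma hoare_prepare:
  "hoare (\<lambda>R N v. R = (\<lambda>_. 0) \<and> N = (\<lambda>_. 0)(0 := n, 1 := B) \<and> v = w) (prepare k) (summing w)"
proof (rule hoare_wp)
  fix R :: "nat \<Rightarrow> real" and N :: "nat \<Rightarrow> nat" and v
  assume init: "R = (\<lambda>_. 0) \<and> N = (\<lambda>_. 0)(0 := n, 1 := B) \<and> v = w"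
  have sel: "sel (\<lambda>_. 0) a = {}" for a
    by (simp add: sel_def)
  show "wp (prepare k) (summing w) R N v"
    using init by (simp add: prepare_def run_append run_replicate_NAdd summing_def fixed_regs_def sel
        list_all_iff) (simp add: bs_def)
qed

lemma hoare_sum_singletons:
  "hoare (summing w) sum_singletons (\<lambda>R N v. summing w R N v \<and> N 0 \<le> N 2)"
  unfolding sum_singletons_def
proof (rule hoare_While)
  fix i
  let ?body = "Block [NAdd 8 11 2, RStore 8 1, Query 5 11, RAdd 4 4 5, RStore 8 2, NAdd 2 2 5]"
  show "hoare (\<lambda>R N v. summing w R N v \<and> N 0 - N 2 = Suc i) ?body
      (\<lambda>R N v. summing w R N v \<and> N 0 - N 2 \<le> i)"
  proof (rule hoare_wp, elim conjE)
    fix R N v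
    assume I: "summing w R N v" and i: "N 0 - N 2 = Suc i"
    have "N 2 < n" "0 < n"
      using I i by (auto simp: summing_def fixed_regs_def)
    then show "wp ?body (\<lambda>R N v. summing w R N v \<and> N 0 - N 2 \<le> i) R N v"
      using I i by (simp add: summing_def fixed_regs_def)
  qed
next
  fix R N v
  assume "summing w R N v"
  then show "N 0 - N 2 \<le> 2 * n + k"
    by (simp add: summing_def fixed_regs_def)
qed

lemma hoare_scale:
  assumes w: "w \<le> f {} \<or> pending 0 w"
  shows "hoare (\<lambda>R N v. summing w R N v \<and> N 0 \<le> N 2) scale main_inv"
proof (rule hoare_wp)
  fix R N v
  assume I: "summing w R N v \<and> N 0 \<le> N 2"
  then have "N 2 = n"
    by (simp add: summing_def fixed_regs_def)
  then have "wp scale (\<lambda>R N v. env (f {}) (real 0 * \<sigma>) 0 R N \<and> v = w) R N v"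
    using I by (simp add: scale_def summing_def env_def fixed_regs_def \<sigma>_def)
  moreover have "main_inv R N v" if "env (f {}) (real 0 * \<sigma>) 0 R N \<and> v = w" for R N v
    unfolding main_inv_def using that w by blast
  ultimately show "wp scale main_inv R N v"
    by (simp add: scale_def)
qed

lemma hoare_main_loop: "hoare main_inv (While 4 15 guess_round)
    (\<lambda>R N v. fixed_regs R N \<and> card (sel R (bs 3)) \<le> 6 * k * B \<and> v \<le> f (sel R (bs 3)))"
proof (rule hoare_conseq[OF hoare_While[OF hoare_guess_round]])
  fix R N v
  assume "main_inv R N v"
  then show "N 15 - N 4 \<le> 2 * n + k"
    by (auto simp: main_inv_def env_def fixed_regs_def)
next
  fix R N v
  assume I: "main_inv R N v \<and> N 15 \<le> N 4"
  then obtain z g where z: "g \<le> 2 * n" "v \<le> z \<or> pending g v" "env z (real g * \<sigma>) g R N"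
    unfolding main_inv_def by blast
  \<comment> \<open>All \<open>2 * n\<close> guesses are used up.\<close>
  then have "\<not> pending g v"
    using I by (auto simp: pending_def env_def fixed_regs_def)
  then show "fixed_regs R N \<and> card (sel R (bs 3)) \<le> 6 * k * B \<and> v \<le> f (sel R (bs 3))"
    using z by (auto simp: env_def)
qed

lemma hoare_copy_best:
  "hoare (\<lambda>R N v. fixed_regs R N \<and> card (sel R (bs 3)) \<le> 6 * k * B \<and> v \<le> f (sel R (bs 3))) copy_best
    (\<lambda>R N v. card {i. i < n \<and> R i \<noteq> 0} \<le> 6 * k * B \<and> v \<le> f {i. i < n \<and> R i \<noteq> 0})"
proof -
  \<comment> \<open>Copying writes below \<open>n\<close> and may destroy real scalars and array 0,
    so only nat registers and array 3 are tracked.\<close>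
  define I where "I R N v \<longleftrightarrow> N 5 = 1 \<and> N 13 = bs 3 \<and> N 18 = 0 \<and> N 2 \<le> n \<and>
    card (sel R (bs 3)) \<le> 6 * k * B \<and> v \<le> f (sel R (bs 3)) \<and>
    (\<forall>x<n. N 2 \<le> x \<longrightarrow> R x = R (bs 3 + x))" for R :: "nat \<Rightarrow> real" and N :: "nat \<Rightarrow> nat" and v
  let ?body = "Block [NSub 2 2 5, NAdd 8 13 2, RLoad 0 8, RStore 2 0]"
  have low: "bs 3 + x \<noteq> m" "m \<noteq> bs 3 + x" if "m < n" for x m
    using that by (auto simp: bs_def)
  have sel_low: "sel (R(m := y)) (bs 3) = sel R (bs 3)" if "m < n" for R m y
    using low[OF that] by (auto simp: sel_def)
  have "hoare (\<lambda>R N v. fixed_regs R N \<and> card (sel R (bs 3)) \<le> 6 * k * B \<and> v \<le> f (sel R (bs 3)))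
      (Block [NAdd 2 0 18]) I"
    by (rule hoare_wp) (simp add: I_def fixed_regs_def)
  moreover have "hoare I (While 18 2 ?body)
      (\<lambda>R N v. card {i. i < n \<and> R i \<noteq> 0} \<le> 6 * k * B \<and> v \<le> f {i. i < n \<and> R i \<noteq> 0})"
  proof (rule hoare_conseq[OF hoare_While])
    fix i
    show "hoare (\<lambda>R N v. I R N v \<and> N 2 - N 18 = Suc i) ?body (\<lambda>R N v. I R N v \<and> N 2 - N 18 \<le> i)"
    proof (rule hoare_wp, elim conjE)
      fix R N v
      assume I: "I R N v" and i: "N 2 - N 18 = Suc i"
      have N: "N 2 = Suc i" "i < n"
        using I i by (auto simp: I_def)
      have "(R(0 := R (bs 3 + i), i := R (bs 3 + i))) x = (R(0 := R (bs 3 + i), i := R (bs 3 + i))) (bs 3 + x)"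
        if "x < n" "i \<le> x" for x
        using that I N low by (auto simp: I_def)
      then show "wp ?body (\<lambda>R N v. I R N v \<and> N 2 - N 18 \<le> i) R N v"
        using I N by (simp add: I_def sel_low)
    qed
  next
    fix R N v
    assume "I R N v"
    then show "N 2 - N 18 \<le> 2 * n + k"
      by (simp add: I_def)
  next
    fix R N v
    assume I: "I R N v \<and> N 2 \<le> N 18"
    then have "{i. i < n \<and> R i \<noteq> 0} = sel R (bs 3)"
      by (auto simp: I_def sel_def)
    then show "card {i. i < n \<and> R i \<noteq> 0} \<le> 6 * k * B \<and> v \<le> f {i. i < n \<and> R i \<noteq> 0}"
      using I by (simp add: I_def)
  qed
  ultimately show ?thesis
    unfolding copy_best_def by (rule hoare_Seq)
qed

lemma good_bicriteria_program:
  "good (code (bicriteria_program k) 0) (init n B) (cost (2 * n + k) (bicriteria_program k))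
    (F / 2 - 2 * F / k)"
proof -
  have "hoare (\<lambda>R N v. R = (\<lambda>_. 0) \<and> N = (\<lambda>_. 0)(0 := n, 1 := B) \<and> v = F / 2 - 2 * F / k)
      (bicriteria_program k)
      (\<lambda>R N v. card {i. i < n \<and> R i \<noteq> 0} \<le> 6 * k * B \<and> v \<le> f {i. i < n \<and> R i \<noteq> 0})"
    unfolding bicriteria_program_def
    by (rule hoare_Seq[OF hoare_prepare hoare_Seq[OF hoare_sum_singletons
        hoare_Seq[OF hoare_scale[OF exists_guess] hoare_Seq[OF hoare_main_loop hoare_copy_best]]]])
  then show ?thesis
    unfolding init_def by (rule hoare_program) auto
qed

end

theorem theorem3p1:
  shows "\<exists>C::real. C > 0 \<and>
    (\<forall>\<epsilon>::real. 0 < \<epsilon> \<and> \<epsilon> < 1/2 \<longrightarrow>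
       (\<exists>P. poly_bicriteria_alg (1/2 - \<epsilon>) (C / \<epsilon>) P))"
proof (intro exI[of _ 15] conjI allI impI)
  fix \<epsilon> :: real
  assume "0 < \<epsilon> \<and> \<epsilon> < 1/2"
  then have \<epsilon>: "0 < \<epsilon>" "\<epsilon> < 1/2"
    by auto
  \<comment> \<open>Makes the total loss \<open>2 * F / k\<close> at most
    \<open>\<epsilon> * F\<close>. As \<open>k\<close> depends on \<open>\<epsilon>\<close> alone,
    one program serves all instances.\<close>
  define k where "k = nat \<lceil>2 / \<epsilon>\<rceil>"
  have "0 \<le> 2 / \<epsilon>"
    using \<epsilon> by simp
  then have k: "2 / \<epsilon> \<le> real k" "real k \<le> 2 / \<epsilon> + 1"
    unfolding k_def by linarith+
  have "0 < 2 / \<epsilon>"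
    using \<epsilon> by simp
  then have k1: "1 \<le> k"
    using k(1) by (cases k) auto
  \<comment> \<open>Since \<open>\<epsilon> < 1/2\<close>, rounding up costs at most
    \<open>1 / (2 \<epsilon>)\<close>; thus \<open>k \<le> 5 / (2 \<epsilon>)\<close>, and the
    factor 6 gives 15.\<close>
  have k_le: "real (6 * k) \<le> 15 / \<epsilon>"
  proof -
    have "1 \<le> (1 / 2) / \<epsilon>"
      using \<epsilon> by simp
    then show ?thesis
      using k(2) by (simp add: field_simps)
  qed
  have k_ge: "2 / k \<le> \<epsilon>"
    using k(1) \<epsilon> k1 by (simp add: field_simps)
  define P where "P = code (bicriteria_program k) 0"
  obtain a d where ad: "\<And>K. cost K (bicriteria_program k) \<le> a * (K + 1) ^ d"
    using cost_polynomial by blast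
  \<comment> \<open>From \<open>2 * n + k + 1 \<le> (k + 2) * (n + 1)\<close>, which separates the
    constant \<open>k\<close> from \<open>n\<close>.\<close>
  define c where "c = a * (k + 2) ^ d"
  have T: "cost (2 * n + k) (bicriteria_program k) \<le> c * (n + 1) ^ d" for n
  proof -
    have "2 * n + k + 1 \<le> (k + 2) * (n + 1)"
      by (simp add: algebra_simps)
    then have "a * (2 * n + k + 1) ^ d \<le> a * ((k + 2) * (n + 1)) ^ d"
      by (intro mult_left_mono power_mono) auto
    also have "a * ((k + 2) * (n + 1)) ^ d = c * (n + 1) ^ d"
      unfolding c_def power_mult_distrib by (rule mult.assoc[symmetric])
    finally show ?thesis
      using ad[of "2 * n + k"] by linarith
  qed
  have main: "(\<forall>cs. halted P (run_T P f n B (c * (n + 1) ^ d) cs) \<and>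
        real (card (alg_output n (run_T P f n B (c * (n + 1) ^ d) cs))) \<le> 15 / \<epsilon> * real B) \<and>
      (\<forall>S. S \<subseteq> {..<n} \<and> card S \<le> B \<longrightarrow>
        expected_value P f n B (c * (n + 1) ^ d) \<ge> (1/2 - \<epsilon>) * f S)"
    if nn: "nonneg_on {..<n} f" and sm: "submodular_on {..<n} f" for n B f
  proof -
    define feasible where "feasible = {S. S \<subseteq> {..<n} \<and> card S \<le> B}"
    have fin: "finite feasible"
      unfolding feasible_def by (rule finite_subset[of _ "Pow {..<n}"]) auto
    have "{} \<in> feasible"
      by (simp add: feasible_def)
    then obtain opt where optimal: "opt \<in> feasible" "\<And>S. S \<in> feasible \<Longrightarrow> f S \<le> f opt"
      using Max_in[of "f ` feasible"] Max_ge[of "f ` feasible"] fin by fastforce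
    interpret bicriteria f n k B "f opt" opt
    proof
      show "f {x} \<le> f opt" if "x < n" "1 \<le> B" for x
        using that by (intro optimal(2)) (auto simp: feasible_def)
    qed (use nn sm k1 optimal(1) in \<open>auto simp: feasible_def\<close>)
    have "good P (init n B) (c * (n + 1) ^ d) (f opt / 2 - 2 * f opt / k)"
      unfolding P_def by (rule good_mono[OF good_bicriteria_program T]) simp
    then have halt: "halted P (run_T P f n B (c * (n + 1) ^ d) cs)"
      "card (alg_output n (run_T P f n B (c * (n + 1) ^ d) cs)) \<le> 6 * k * B"
      and val: "f opt / 2 - 2 * f opt / k \<le> expected_value P f n B (c * (n + 1) ^ d)" for cs
      unfolding good_def run_T_def expected_value_def mean_def by auto
    have "real (card (alg_output n (run_T P f n B (c * (n + 1) ^ d) cs))) \<le> 15 / \<epsilon> * real B" for cs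
    proof -
      have "real (card (alg_output n (run_T P f n B (c * (n + 1) ^ d) cs))) \<le> real (6 * k) * real B"
        using halt(2)[of cs] by (metis of_nat_le_iff of_nat_mult)
      also have "\<dots> \<le> 15 / \<epsilon> * real B"
        using k_le by (intro mult_right_mono) auto
      finally show ?thesis .
    qed
    moreover have "(1/2 - \<epsilon>) * f S \<le> expected_value P f n B (c * (n + 1) ^ d)"
      if "S \<subseteq> {..<n} \<and> card S \<le> B" for S
    proof -
      have "(1/2 - \<epsilon>) * f S \<le> (1/2 - \<epsilon>) * f opt"
        using that \<epsilon> by (intro mult_left_mono optimal(2)) (auto simp: feasible_def)
      also have "\<dots> \<le> f opt / 2 - 2 * f opt / k"
      proof -
        have "2 / k * f opt \<le> \<epsilon> * f opt"
          using k_ge F_nonneg by (rule mult_right_mono)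
        moreover have "(1/2 - \<epsilon>) * f opt = f opt / 2 - \<epsilon> * f opt"
          by (simp add: left_diff_distrib)
        moreover have "2 / k * f opt = 2 * f opt / k"
          by simp
        ultimately show ?thesis
          by linarith
      qed
      also note val
      finally show ?thesis .
    qed
    ultimately show ?thesis
      using halt(1) by blast
  qed
  show "\<exists>P. poly_bicriteria_alg (1/2 - \<epsilon>) (15 / \<epsilon>) P"
    unfolding poly_bicriteria_alg_def Let_def using main by blast
qed simp

end
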